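(* Let $d\ge 2$, let $r/s$ be an irreducible fraction with $s>0$, and let $\gamma\in\Gamma=\mathrm{PSL}(2,\mathbb{Z})$ satisfy $\gamma(\infty)=r/s$. Then: (1) $\Phi_d(q)$ divides $\mathcal{S}_{r/s}(q)$ if and only if $\gamma\in\langle R\rangle N_d$. (2) $\Phi_d(q)$ divides $\mathcal{R}_{r/s}(q)$ if and only if $\gamma\in S\langle R\rangle N_d$.
   Context: $q$-deformed rationals: every irreducible fraction $r/s>1$ has a unique Hirzebruch--Jung expansion $r/s=[\![c_1,\dots,c_k]\!]=c_1-\cfrac{1}{c_2-\cfrac{1}{\ddots-\cfrac{1}{c_k}}}$ with all $c_i\ge 2$ integers. Put $R_q=\begin{pmatrix}q&1\\0&1\end{pmatrix}$, $S_q=\begin{pmatrix}0&-q^{-1}\\1&0\end{pmatrix}$ and $M_q(c_1,\dots,c_k)=R_q^{c_1}S_q\cdots R_q^{c_k}S_q$. For $r/s=[\![c_1,\dots,c_k]\!]>1$, the polynomials $\mathcal{R}_{r/s}(q),\mathcal{S}_{r/s}(q)\in\mathbb{Z}[q]$ are the upper and lower entries of the first column of $M_q(c_1,\dots,c_k)$, and $[r/s]_q=\mathcal{R}_{r/s}(q)/\mathcal{S}_{r/s}(q)$. This is extended to $\mathbb{Q}\cup\{\infty\}$ by $[\alpha+1]_q=q[\alpha]_q+1$, $[0/1]_q=0$, $[1/0]_q=1/0$. For an arbitrary irreducible fraction $r/s$ with $s>0$, $\mathcal{R}_{r/s}(q)$ and $\mathcal{S}_{r/s}(q)$ are the coprime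 Laurent polynomials with integer coefficients such that $[r/s]_q=\mathcal{R}_{r/s}(q)/\mathcal{S}_{r/s}(q)$, $\mathcal{S}_{r/s}(q)\in\mathbb{Z}[q]$ and $\mathcal{S}_{r/s}(0)=1$. Divisibility of Laurent polynomials is in $\mathbb{Z}[q^{\pm1}]$. $\Phi_d(q)$ is the $d$-th cyclotomic polynomial. Modular group: $\Gamma=\mathrm{PSL}(2,\mathbb{Z})$ acts on $\mathbb{Q}\cup\{\infty\}$ by M\"obius transformations; $R$ and $S$ are the images in $\Gamma$ of $\begin{pmatrix}1&1\\0&1\end{pmatrix}$ and $\begin{pmatrix}0&-1\\1&0\end{pmatrix}$. For $d\ge2$, $N_d$ is the normal closure of $R^d$ in $\Gamma$; since $N_d$ is normal, $\langle R\rangle N_d$ is a subgroup of $\Gamma$. *)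

theory Defs
  imports
    "HOL-Analysis.Analysis"
    "HOL-Algebra.Generated_Groups"
    "HOL-Computational_Algebra.Polynomial_Factorial"
    "HOL-Computational_Algebra.Fraction_Field"
    "HOL-Computational_Algebra.Fundamental_Theorem_Algebra"
    "HOL-Library.Poly_Mapping"
    "HOL-Number_Theory.Totient"
begin

section \<open>Laurent polynomials with integer coefficients\<close>

text \<open>
  The monoid algebra of \<open>(\<int>, +)\<close> over \<open>\<int>\<close> is \<open>\<int>[q, q\<^sup>-\<^sup>1]\<close>: the finitely supported function \<open>f\<close>
  is \<open>\<Sum>n. f(n) q^n\<close>, multiplication is convolution, and \<open>dvd\<close> on this type is divisibility
  in \<open>\<int>[q, q\<^sup>-\<^sup>1]\<close>.
\<close>

type_synonym laurent = "int \<Rightarrow>\<^sub>0 int"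

definition qv :: laurent where "qv = Poly_Mapping.single 1 1"

definition qv_inv :: laurent where "qv_inv = Poly_Mapping.single (-1) 1"

definition laurent_of_poly :: "int poly \<Rightarrow> laurent" where
  "laurent_of_poly p = poly (map_poly of_int p) qv"

text \<open>
  The library constant \<open>coprime\<close> needs a type class with a division operation, which Laurent
  polynomials do not have; this is its defining property.
\<close>

definition laurent_coprime :: "laurent \<Rightarrow> laurent \<Rightarrow> bool" where
  "laurent_coprime a b \<longleftrightarrow> (\<forall>c. c dvd a \<longrightarrow> c dvd b \<longrightarrow> c dvd 1)"


lemma qv_mult_inv: "qv * qv_inv = 1"
  by (simp add: qv_def qv_inv_def mult_single)

lemma qv_mult_inv_left [simp]: "qv * (qv_inv * x) = x"
  by (simp add: qv_mult_inv flip: mult.assoc)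

lemma qv_nonzero [simp]: "qv \<noteq> 0"
  using qv_mult_inv by auto

lemma map_poly_of_int_add:
  "map_poly of_int (p + r) = map_poly of_int p + (map_poly of_int r :: 'a::comm_ring_1 poly)"
  by (rule poly_eqI) (simp add: coeff_map_poly)

lemma map_poly_of_int_diff:
  "map_poly of_int (p - r) = map_poly of_int p - (map_poly of_int r :: 'a::comm_ring_1 poly)"
  by (rule poly_eqI) (simp add: coeff_map_poly)

lemma map_poly_of_int_mult:
  "map_poly of_int (p * r) = map_poly of_int p * (map_poly of_int r :: 'a::comm_ring_1 poly)"
  by (rule poly_eqI) (simp add: coeff_map_poly coeff_mult)

lemma laurent_of_poly_simps [simp]:
  "laurent_of_poly 0 = 0" "laurent_of_poly 1 = 1"
  "laurent_of_poly (p + r) = laurent_of_poly p + laurent_of_poly r"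
  "laurent_of_poly (p - r) = laurent_of_poly p - laurent_of_poly r"
  "laurent_of_poly (p * r) = laurent_of_poly p * laurent_of_poly r"
  "laurent_of_poly (pCons a p) = of_int a + qv * laurent_of_poly p"
  by (simp_all add: laurent_of_poly_def map_poly_of_int_add map_poly_of_int_diff
    map_poly_of_int_mult map_poly_pCons)

lemma laurent_of_poly_power [simp]: "laurent_of_poly (p ^ n) = laurent_of_poly p ^ n"
  by (induction n) simp_all

lemma qv_power: "qv ^ n = Poly_Mapping.single (int n) 1"
  by (induction n) (simp_all add: qv_def mult_single algebra_simps)

lemma lookup_laurent_of_poly:
  "Poly_Mapping.lookup (laurent_of_poly p) k = (if k < 0 then 0 else coeff p (nat k))"
proof -
  define m where "m = degree p + nat k"
  have deg: "degree (map_poly of_int p :: laurent poly) \<le> m"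
    unfolding m_def by (rule order_trans[OF map_poly_degree_leq]) simp_all
  have "laurent_of_poly p =
      (\<Sum>i\<le>degree (map_poly of_int p :: laurent poly). of_int (coeff p i) * qv ^ i)"
    unfolding laurent_of_poly_def by (simp add: poly_altdef coeff_map_poly)
  also have "\<dots> = (\<Sum>i\<le>m. of_int (coeff p i) * qv ^ i)"
  proof (rule sum.mono_neutral_left)
    show "\<forall>i\<in>{..m} - {..degree (map_poly of_int p :: laurent poly)}.
        of_int (coeff p i) * qv ^ i = 0"
    proof
      fix i assume "i \<in> {..m} - {..degree (map_poly of_int p :: laurent poly)}"
      then have "coeff (map_poly of_int p :: laurent poly) i = 0"
        by (intro coeff_eq_0) auto
      then show "of_int (coeff p i) * qv ^ i = 0" by (simp add: coeff_map_poly)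
    qed
  qed (use deg in auto)
  also have "\<dots> = (\<Sum>i\<le>m. Poly_Mapping.single (int i) (coeff p i))"
    by (intro sum.cong refl) (simp add: qv_power mult_single flip: single_of_int)
  finally have "Poly_Mapping.lookup (laurent_of_poly p) k
      = (\<Sum>i\<le>m. if int i = k then coeff p i else 0)"
    by (simp add: lookup_sum lookup_single when_def)
  also have "\<dots> = (\<Sum>i\<le>m. if i = nat k then (if k < 0 then 0 else coeff p (nat k)) else 0)"
    by (intro sum.cong refl) auto
  also have "\<dots> = (if k < 0 then 0 else coeff p (nat k))"
    by (simp add: m_def)
  finally show ?thesis .
qed

lemma laurent_of_poly_inject [simp]: "laurent_of_poly p = laurent_of_poly r \<longleftrightarrow> p = r"
proof
  assume eq: "laurent_of_poly p = laurent_of_poly r"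
  have "coeff p n = coeff r n" for n
    using lookup_laurent_of_poly[of p "int n"] lookup_laurent_of_poly[of r "int n"] eq by simp
  then show "p = r" by (simp add: poly_eq_iff)
qed simp

lemma laurent_shift: "\<exists>n p. f * qv ^ n = laurent_of_poly p"
proof -
  have sing: "\<exists>n p. Poly_Mapping.single k a * qv ^ n = laurent_of_poly p" for k a
  proof -
    have "Poly_Mapping.lookup (Poly_Mapping.single k a * qv ^ nat (- k)) j =
        Poly_Mapping.lookup (laurent_of_poly (monom a (nat k))) j" for j
      by (auto simp: qv_power mult_single lookup_single lookup_laurent_of_poly when_def)
    then show ?thesis by (metis poly_mapping_eqI)
  qed
  have sm: "\<exists>n p. (\<Sum>k\<in>A. Poly_Mapping.single k (Poly_Mapping.lookup f k)) * qv ^ n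
      = laurent_of_poly p" if "finite A" for A
    using that
  proof induction
    case empty
    show ?case by (rule exI[of _ 0], rule exI[of _ 0]) simp
  next
    case (insert x A)
    obtain n p where 1: "(\<Sum>k\<in>A. Poly_Mapping.single k (Poly_Mapping.lookup f k)) * qv ^ n
      = laurent_of_poly p" using insert by blast
    obtain m r where 2: "Poly_Mapping.single x (Poly_Mapping.lookup f x) * qv ^ m
      = laurent_of_poly r" using sing by blast
    have X: "laurent_of_poly [:0, 1:] = qv" by simp
    have "(\<Sum>k\<in>insert x A. Poly_Mapping.single k (Poly_Mapping.lookup f k)) * qv ^ (m + n)
      = (Poly_Mapping.single x (Poly_Mapping.lookup f x) * qv ^ m) * qv ^ n +
        ((\<Sum>k\<in>A. Poly_Mapping.single k (Poly_Mapping.lookup f k)) * qv ^ n) * qv ^ m"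
      using insert by (simp add: algebra_simps power_add)
    also have "\<dots> = laurent_of_poly (r * [:0, 1:] ^ n + p * [:0, 1:] ^ m)"
      unfolding 1 2 laurent_of_poly_simps laurent_of_poly_power by simp
    finally show ?case by blast
  qed
  have "(\<Sum>k\<in>Poly_Mapping.keys f. Poly_Mapping.single k (Poly_Mapping.lookup f k)) = f"
    by (rule poly_mapping_eqI)
      (simp add: lookup_sum lookup_single when_def not_in_keys_iff_lookup_eq_zero)
  with sm[of "Poly_Mapping.keys f"] show ?thesis by simp
qed

lemma qv_power_inv: "qv ^ n * qv_inv ^ n = 1"
  by (metis power_mult_distrib power_one qv_mult_inv)


section \<open>Hirzebruch--Jung expansions and \<open>q\<close>-rationals\<close>

fun hj_value :: "nat list \<Rightarrow> rat" where
  "hj_value [] = 0"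
| "hj_value [c] = of_nat c"
| "hj_value (c # d # cs) = of_nat c - 1 / hj_value (d # cs)"

definition is_hj_expansion :: "rat \<Rightarrow> nat list \<Rightarrow> bool" where
  "is_hj_expansion x cs \<longleftrightarrow> cs \<noteq> [] \<and> (\<forall>c\<in>set cs. c \<ge> 2) \<and> hj_value cs = x"

definition hj_expansion :: "rat \<Rightarrow> nat list" where
  "hj_expansion x = (THE cs. is_hj_expansion x cs)"

definition Rq :: "laurent^2^2" where
  "Rq = vector [vector [qv, 1], vector [0, 1]]"

definition Sq :: "laurent^2^2" where
  "Sq = vector [vector [0, - qv_inv], vector [1, 0]]"

definition mat_pow :: "'a::semiring_1^'n^'n \<Rightarrow> nat \<Rightarrow> 'a^'n^'n" where
  "mat_pow A n = (((**) A) ^^ n) (mat 1)"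

fun Mq :: "nat list \<Rightarrow> laurent^2^2" where
  "Mq [] = mat 1"
| "Mq (c # cs) = mat_pow Rq c ** Sq ** Mq cs"

text \<open>
  The fraction field of the Laurent polynomials is \<open>\<rat>(q)\<close>. For \<open>x > 1\<close> the \<open>q\<close>-rational
  \<open>[x]\<^sub>q\<close> is read off the first column of \<open>M\<^sub>q\<close>; for \<open>x \<le> 1\<close> the relation
  \<open>[x + 1]\<^sub>q = q [x]\<^sub>q + 1\<close> is solved for \<open>[x]\<^sub>q\<close>. That this relation and \<open>[0]\<^sub>q = 0\<close>
  then hold for all rationals is \<open>q_rational_add_1\<close> and \<open>q_rational_0\<close> below. The value
  at \<open>\<infinity>\<close> is not represented.
\<close>

function q_rational :: "rat \<Rightarrow> laurent fract" where
  "q_rational x =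
     (if x > 1
      then Fraction_Field.Fract (Mq (hj_expansion x) $ 1 $ 1) (Mq (hj_expansion x) $ 2 $ 1)
      else (q_rational (x + 1) - 1) / Fraction_Field.Fract qv 1)"
  by auto
termination
proof (relation "Wellfounded.measure (\<lambda>x. nat \<lceil>2 - x\<rceil>)")
  fix x :: rat
  assume "\<not> x > 1"
  then have "\<lceil>2 - x\<rceil> > 0" by simp
  moreover have "\<lceil>2 - (x + 1)\<rceil> = \<lceil>2 - x\<rceil> - 1"
    using ceiling_diff_one[of "2 - x"] by (simp only: diff_diff_add)
  ultimately show "(x + 1, x) \<in> Wellfounded.measure (\<lambda>x. nat \<lceil>2 - x\<rceil>)"
    unfolding in_measure by linarith
qed simp

declare q_rational.simps [simp del]

text \<open>\<open>P = \<R>\<^sub>x\<close> and \<open>Q = \<S>\<^sub>x\<close>; membership of the latter in \<open>\<int>[q]\<close> is expressed by its type.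
  Existence and uniqueness are \<open>is_q_fraction_q_numer_denom\<close> and \<open>is_q_fraction_unique\<close>.\<close>

definition is_q_fraction :: "rat \<Rightarrow> laurent \<Rightarrow> int poly \<Rightarrow> bool" where
  "is_q_fraction x P Q \<longleftrightarrow>
     laurent_coprime P (laurent_of_poly Q) \<and> poly Q 0 = 1 \<and>
     q_rational x = Fraction_Field.Fract P (laurent_of_poly Q)"

definition q_numer :: "rat \<Rightarrow> laurent" where
  "q_numer x = (THE P. \<exists>Q. is_q_fraction x P Q)"

definition q_denom :: "rat \<Rightarrow> int poly" where
  "q_denom x = (THE Q. \<exists>P. is_q_fraction x P Q)"


lemma is_q_fraction_coprime:
  assumes "is_q_fraction x P Q" "P * qv ^ n = laurent_of_poly p"
  shows "coprime Q p" "coprime Q ([:0, 1:] ^ k)"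
proof -
  obtain R where R: "Q = pCons 1 R"
    using assms(1) by (cases Q) (auto simp: is_q_fraction_def)
  have "coprime Q [:0, 1:]"
  proof (rule coprimeI)
    fix c assume "c dvd Q" "c dvd [:0, 1:]"
    then have "c dvd Q - [:0, 1:] * R" by (meson dvd_diff dvd_mult2)
    also have "Q - [:0, 1:] * R = 1" by (simp add: R one_pCons)
    finally show "c dvd 1" .
  qed
  then show X: "coprime Q ([:0, 1:] ^ k)" for k by simp
  show "coprime Q p"
  proof (rule coprimeI)
    fix c assume c: "c dvd Q" "c dvd p"
    have "laurent_of_poly c dvd laurent_of_poly Q" "laurent_of_poly c dvd laurent_of_poly p"
      using c by (auto simp: dvd_def)
    moreover have "P = laurent_of_poly p * qv_inv ^ n"
      using assms(2) by (metis mult.assoc mult.right_neutral qv_power_inv)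
    ultimately have "laurent_of_poly c dvd 1"
      using assms(1) by (auto simp: is_q_fraction_def laurent_coprime_def)
    then obtain u where u: "laurent_of_poly c * u = 1" by (metis dvdE)
    obtain k v where v: "u * qv ^ k = laurent_of_poly v" using laurent_shift by blast
    have "laurent_of_poly (c * v) = laurent_of_poly ([:0, 1:] ^ k)"
      unfolding laurent_of_poly_simps(5) laurent_of_poly_power v[symmetric]
      using u by (simp flip: mult.assoc)
    then have "c dvd [:0, 1:] ^ k" by (metis laurent_of_poly_inject dvd_triv_left)
    with c(1) X show "c dvd 1" by (meson coprime_common_divisor)
  qed
qed

lemma is_q_fraction_unique:
  assumes "is_q_fraction x P Q" "is_q_fraction x P' Q'"
  shows "P = P'" "Q = Q'"
proof -
  have div: "Q dvd Q'" and eq: "P * laurent_of_poly Q' = P' * laurent_of_poly Q"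
    if 1: "is_q_fraction x P Q" and 2: "is_q_fraction x P' Q'" for P Q P' Q'
  proof -
    have nz: "laurent_of_poly Q \<noteq> 0" "laurent_of_poly Q' \<noteq> 0"
      using 1 2 laurent_of_poly_inject[of Q 0] laurent_of_poly_inject[of Q' 0]
      by (auto simp: is_q_fraction_def)
    show eq: "P * laurent_of_poly Q' = P' * laurent_of_poly Q"
      using 1 2 nz by (simp add: is_q_fraction_def eq_fract)
    obtain n p where p: "P * qv ^ n = laurent_of_poly p" using laurent_shift by blast
    obtain n' p' where p': "P' * qv ^ n' = laurent_of_poly p'" using laurent_shift by blast
    have "laurent_of_poly (p * [:0, 1:] ^ n' * Q') = laurent_of_poly (Q * (p' * [:0, 1:] ^ n))"
      unfolding laurent_of_poly_simps(5) laurent_of_poly_power p[symmetric] p'[symmetric]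
      using eq by (simp add: algebra_simps)
    then have "Q dvd p * [:0, 1:] ^ n' * Q'" by (metis laurent_of_poly_inject dvd_triv_left)
    then show "Q dvd Q'"
      using is_q_fraction_coprime[OF 1 p]
      by (simp add: coprime_dvd_mult_right_iff)
  qed
  have "Q dvd Q'" "Q' dvd Q" using div assms by blast+
  then obtain u v where uv: "Q' = Q * u" "Q = Q' * v" by (metis dvdE)
  have Q: "poly Q 0 = 1" "poly Q' 0 = 1" using assms by (auto simp: is_q_fraction_def)
  then have "Q \<noteq> 0" by auto
  moreover have "Q * (u * v) = Q * 1" using uv by (metis mult.assoc mult.right_neutral)
  ultimately have "u * v = 1" by (metis mult_cancel_left)
  then have "u \<noteq> 0" "v \<noteq> 0" "degree (u * v) = 0" by auto
  then have "degree u = 0" by (simp add: degree_mult_eq)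
  then obtain a where "u = [:a:]" by (metis degree_eq_zeroE)
  then have "u = 1" using uv(1) Q by (simp add: one_pCons)
  then show "Q = Q'" using uv by simp
  then show "P = P'" using eq[OF assms] \<open>Q \<noteq> 0\<close>
    by (metis laurent_of_poly_inject laurent_of_poly_simps(1) mult_cancel_right)
qed

lemma hj_value_bounds_aux:
  "cs \<noteq> [] \<Longrightarrow> \<forall>c\<in>set cs. c \<ge> 2 \<Longrightarrow>
     hj_value cs > 1 \<and> of_nat (hd cs) - 1 < hj_value cs \<and> hj_value cs \<le> of_nat (hd cs)"
proof (induction cs rule: hj_value.induct)
  case (3 c d cs)
  then have IH: "hj_value (d # cs) > 1" by simp
  then have "1 / hj_value (d # cs) < 1" "1 / hj_value (d # cs) > 0" by simp_all
  moreover have "(of_nat c :: rat) \<ge> 2"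
    using "3.prems" by (metis list.set_intros(1) of_nat_le_iff of_nat_numeral)
  ultimately show ?case unfolding hj_value.simps list.sel by linarith
qed auto

lemma hj_value_bounds:
  assumes "cs \<noteq> []" "\<forall>c\<in>set cs. c \<ge> 2"
  shows "hj_value cs > 1" "of_nat (hd cs) - 1 < hj_value cs" "hj_value cs \<le> of_nat (hd cs)"
  using hj_value_bounds_aux[OF assms] by blast+

lemma is_hj_expansion_hd:
  assumes "is_hj_expansion x cs"
  shows "int (hd cs) = \<lceil>x\<rceil>"
  using assms hj_value_bounds[of cs] unfolding is_hj_expansion_def
  by (metis ceiling_unique of_int_of_nat_eq)

lemma is_hj_expansion_unique:
  "is_hj_expansion x cs \<Longrightarrow> is_hj_expansion x ds \<Longrightarrow> cs = ds"
proof (induction cs arbitrary: x ds)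
  case Nil
  then show ?case by (simp add: is_hj_expansion_def)
next
  case (Cons c cs)
  obtain d es where ds: "ds = d # es" using Cons.prems by (cases ds) (auto simp: is_hj_expansion_def)
  have "int c = int d"
    using Cons.prems[THEN is_hj_expansion_hd] by (simp add: ds)
  then have cd: "c = d" by simp
  have ne: "hj_value (e # xs) \<noteq> of_nat e - 1 / hj_value (f # ys)"
    if "\<forall>c\<in>set (f # ys). c \<ge> 2" "hj_value (e # xs) = of_nat e" for e f xs ys
    using hj_value_bounds(1)[of "f # ys"] that by simp
  show ?case
  proof (cases cs)
    case Nil
    then show ?thesis
      using Cons.prems ne[of _ _ c "[]"] by (cases es) (auto simp: ds cd is_hj_expansion_def)
  next
    case C: (Cons c' cs')
    show ?thesis
    proof (cases es)
      case Nil
      then show ?thesis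
        using Cons.prems ne[of _ _ c "[]"] by (auto simp: ds cd is_hj_expansion_def C)
    next
      case E: (Cons e' es')
      have "1 / hj_value cs = 1 / hj_value es"
        using Cons.prems by (auto simp: is_hj_expansion_def ds C E cd)
      then have "hj_value cs = hj_value es"
        by (metis inverse_eq_divide inverse_inverse_eq)
      then have "cs = es"
        using Cons.prems by (intro Cons.IH[of "hj_value cs"]) (auto simp: is_hj_expansion_def ds C E)
      then show ?thesis by (simp add: ds cd)
    qed
  qed
qed

lemma hj_expansion_exists:
  assumes "x > 1"
  shows "\<exists>cs. is_hj_expansion x cs"
proof -
  have "\<exists>cs. is_hj_expansion (of_int r / of_nat s) cs" if "s > 0" "r > int s" for r s
    using that
  proof (induction s arbitrary: r rule: less_induct)
    case (less s)
    define x where "x = of_int r / (of_nat s :: rat)"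
    have x1: "x > 1" using less.prems unfolding x_def
      by (metis divide_less_eq_1_pos less_divide_eq_1_pos of_int_less_iff of_int_of_nat_eq of_nat_0_less_iff)
    then have c2: "nat \<lceil>x\<rceil> \<ge> 2" by linarith
    have cn: "of_nat (nat \<lceil>x\<rceil>) = (of_int \<lceil>x\<rceil> :: rat)" using c2 by simp
    show ?case
    proof (cases "of_int \<lceil>x\<rceil> = x")
      case True
      then have "is_hj_expansion x [nat \<lceil>x\<rceil>]" using c2 cn by (simp add: is_hj_expansion_def)
      then show ?thesis unfolding x_def by blast
    next
      case False
      define t where "t = \<lceil>x\<rceil> * int s - r"
      have xs: "x * of_nat s = of_int r" using less.prems by (simp add: x_def)
      have tt: "of_int t = (of_int \<lceil>x\<rceil> - x) * (of_nat s :: rat)"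
        by (simp add: t_def algebra_simps xs)
      have d: "of_int \<lceil>x\<rceil> - x > 0" "of_int \<lceil>x\<rceil> - x < 1"
        using False ceiling_correct[of x] by linarith+
      have s0: "(of_nat s :: rat) > 0" using less.prems by simp
      have "(of_int t :: rat) > 0" unfolding tt using d(1) s0 by (rule mult_pos_pos)
      then have t0: "t > 0" by simp
      have "(of_int t :: rat) < of_nat s" unfolding tt using d(2) s0 by (simp add: mult_less_cancel_right1)
      then have ts: "t < int s" by (metis of_int_less_iff of_int_of_nat_eq)
      obtain cs where cs: "is_hj_expansion (of_int (int s) / of_nat (nat t)) cs"
        using less.IH[of "nat t" "int s"] t0 ts by auto
      have "of_int (int s) / of_nat (nat t) = (1 / (of_int \<lceil>x\<rceil> - x) :: rat)"
        using t0 s0 d by (simp add: tt)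
      then have "1 / hj_value cs = of_int \<lceil>x\<rceil> - x" using cs by (simp add: is_hj_expansion_def)
      then have "is_hj_expansion x (nat \<lceil>x\<rceil> # cs)"
        using cs c2 cn unfolding is_hj_expansion_def
        by (cases cs) (simp_all only: hj_value.simps, auto)
      then show ?thesis unfolding x_def by blast
    qed
  qed
  moreover obtain r s where "x = of_int r / of_int s" "s > 0"
    by (metis Rat_cases Fract_of_int_quotient)
  moreover have "r > s" using assms calculation(2,3) by simp
  ultimately show ?thesis
    by (metis of_int_of_nat_eq pos_int_cases zero_less_imp_eq_int)
qed

lemma hj_expansion:
  assumes "x > 1"
  shows "is_hj_expansion x (hj_expansion x)"
  unfolding hj_expansion_def
  using hj_expansion_exists[OF assms] is_hj_expansion_unique by (metis theI)

lemma hj_expansion_eqI: "is_hj_expansion x cs \<Longrightarrow> hj_expansion x = cs"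
  unfolding hj_expansion_def using is_hj_expansion_unique by blast

lemma mat_pow_Suc: "mat_pow A (Suc n) = A ** mat_pow A n"
  by (simp add: mat_pow_def)

lemma Mq_add_one: "Mq (Suc c # cs) = Rq ** Mq (c # cs)"
  by (simp add: mat_pow_Suc matrix_mul_assoc)

lemma mat22_mult:
  fixes A B :: "'a::comm_semiring_1^2^2"
  shows "(A ** B) $ i $ j = A $ i $ 1 * B $ 1 $ j + A $ i $ 2 * B $ 2 $ j"
  by (simp add: matrix_matrix_mult_def sum_2)

lemma Rq_entries [simp]: "Rq $ 1 $ 1 = qv" "Rq $ 1 $ 2 = 1" "Rq $ 2 $ 1 = 0" "Rq $ 2 $ 2 = 1"
  by (simp_all add: Rq_def)

lemma Sq_entries [simp]: "Sq $ 1 $ 1 = 0" "Sq $ 1 $ 2 = - qv_inv" "Sq $ 2 $ 1 = 1" "Sq $ 2 $ 2 = 0"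
  by (simp_all add: Sq_def)

lemma Mq_poly:
  assumes "cs \<noteq> []" "\<forall>c\<in>set cs. c \<ge> 2"
  shows "\<exists>P Q. Mq cs $ 1 $ 1 = laurent_of_poly P \<and> Mq cs $ 2 $ 1 = laurent_of_poly Q \<and>
      poly P 0 = 1 \<and> poly Q 0 = 1"
  using assms
proof (induction cs)
  case Nil then show ?case by simp
next
  case (Cons c cs)
  have base: "\<exists>P Q. Mq cs $ 1 $ 1 = laurent_of_poly P \<and> Mq cs $ 2 $ 1 = laurent_of_poly Q \<and>
      poly P 0 = 1"
  proof (cases "cs = []")
    case True
    have "Mq cs $ 1 $ 1 = laurent_of_poly 1" "Mq cs $ 2 $ 1 = laurent_of_poly 0"
      by (simp_all add: True mat_def)
    then show ?thesis by (metis poly_1)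
  qed (use Cons in auto)
  then obtain P Q where PQ: "Mq cs $ 1 $ 1 = laurent_of_poly P" "Mq cs $ 2 $ 1 = laurent_of_poly Q"
     "poly P 0 = 1" by blast
  have Mc: "Mq (Suc n # ds) $ 1 $ 1 = qv * Mq (n # ds) $ 1 $ 1 + Mq (n # ds) $ 2 $ 1"
    "Mq (Suc n # ds) $ 2 $ 1 = Mq (n # ds) $ 2 $ 1" for n ds
    unfolding Mq_add_one mat22_mult by simp_all
  have M0: "Mq (0 # cs) $ 1 $ 1 = - qv_inv * laurent_of_poly Q" "Mq (0 # cs) $ 2 $ 1 = laurent_of_poly P"
    by (simp_all add: mat_pow_def mat22_mult PQ del: mat_0)
  have "Mq (Suc 0 # cs) $ 1 $ 1 = laurent_of_poly (P - Q)" "Mq (Suc 0 # cs) $ 2 $ 1 = laurent_of_poly P"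
    unfolding Mc M0 by (simp_all add: qv_mult_inv flip: mult.assoc)
  then have step: "\<exists>P' Q'. Mq (Suc (Suc n) # cs) $ 1 $ 1 = laurent_of_poly P' \<and>
     Mq (Suc (Suc n) # cs) $ 2 $ 1 = laurent_of_poly Q' \<and> poly P' 0 = 1 \<and> poly Q' 0 = 1" for n
  proof (induction n)
    case 0
    have "Mq (Suc (Suc 0) # cs) $ 1 $ 1 = laurent_of_poly (pCons 0 (P - Q) + P)"
      "Mq (Suc (Suc 0) # cs) $ 2 $ 1 = laurent_of_poly P"
      unfolding Mc(1)[of "Suc 0"] Mc(2)[of "Suc 0"] 0 by simp_all
    moreover have "poly (pCons 0 (P - Q) + P) 0 = 1" using PQ by simp
    ultimately show ?case using PQ(3) by blast
  next
    case (Suc n)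
    then obtain P' Q' where *: "Mq (Suc (Suc n) # cs) $ 1 $ 1 = laurent_of_poly P'"
     "Mq (Suc (Suc n) # cs) $ 2 $ 1 = laurent_of_poly Q'" "poly P' 0 = 1" "poly Q' 0 = 1" by blast
    have "Mq (Suc (Suc (Suc n)) # cs) $ 1 $ 1 = laurent_of_poly (pCons 0 P' + Q')"
      "Mq (Suc (Suc (Suc n)) # cs) $ 2 $ 1 = laurent_of_poly Q'"
      unfolding Mc(1)[of "Suc (Suc n)"] Mc(2)[of "Suc (Suc n)"] * by simp_all
    moreover have "poly (pCons 0 P' + Q') 0 = 1" using * by simp
    ultimately show ?case using *(4) by blast
  qed
  have "c \<ge> 2" using Cons by simp
  then obtain n where "c = Suc (Suc n)" by (metis add_2_eq_Suc le_Suc_ex)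
  then show ?case using step by simp
qed

lemma det_Mq_unit: "det (Mq cs) dvd 1"
proof -
  have dR: "det Rq dvd 1" by (metis det_2 Rq_entries dvdI mult_1_right mult_zero_right diff_zero qv_mult_inv)
  have dS: "det Sq dvd 1"
    using qv_mult_inv by (auto simp: det_2 dvd_def mult.commute)
  have dP: "det (mat_pow Rq n) dvd 1" for n
    using dR mult_dvd_mono[of "det Rq" 1 _ 1]
    by (induction n) (auto simp: mat_pow_def[of _ 0] mat_pow_Suc det_mul)
  have mm: "a * b dvd 1" if "a dvd 1" "b dvd 1" for a b :: laurent
    using mult_dvd_mono[OF that] by simp
  show ?thesis using dP dS by (induction cs) (simp_all add: det_mul mm)
qed

lemma Mq_coprime: "laurent_coprime (Mq cs $ 1 $ 1) (Mq cs $ 2 $ 1)"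
  unfolding laurent_coprime_def
proof (intro allI impI)
  fix c assume "c dvd Mq cs $ 1 $ 1" "c dvd Mq cs $ 2 $ 1"
  then have "c dvd det (Mq cs)" unfolding det_2 by (intro dvd_diff) auto
  then show "c dvd 1" using det_Mq_unit dvd_trans by blast
qed

lemma q_rational_gt_1:
  assumes "x > 1"
  shows "q_rational x = Fraction_Field.Fract (Mq (hj_expansion x) $ 1 $ 1) (Mq (hj_expansion x) $ 2 $ 1)"
  using assms by (subst q_rational.simps) simp

lemma q_rational_add_1: "q_rational (x + 1) = Fraction_Field.Fract qv 1 * q_rational x + 1"
proof (cases "x > 1")
  case False
  have "Fraction_Field.Fract qv 1 \<noteq> 0" by (simp add: Zero_fract_def eq_fract)
  with False show ?thesis by (subst (2) q_rational.simps) simp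
next
  case True
  obtain c cs where c: "hj_expansion x = c # cs"
    using hj_expansion[OF True] by (cases "hj_expansion x") (auto simp: is_hj_expansion_def)
  have "is_hj_expansion (x + 1) (Suc c # cs)"
    using hj_expansion[OF True] unfolding c by (cases cs) (auto simp: is_hj_expansion_def)
  then have c': "hj_expansion (x + 1) = Suc c # cs" by (rule hj_expansion_eqI)
  obtain P Q where PQ: "Mq (c # cs) $ 1 $ 1 = laurent_of_poly P" "Mq (c # cs) $ 2 $ 1 = laurent_of_poly Q"
     "poly Q 0 = 1"
    using Mq_poly[of "c # cs"] hj_expansion[OF True] by (auto simp: c is_hj_expansion_def)
  have nz: "Mq (c # cs) $ 2 $ 1 \<noteq> 0"
    using PQ laurent_of_poly_inject[of Q 0] by auto
  have "x + 1 > 1" using True by simp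
  then show ?thesis using nz
    by (simp add: q_rational_gt_1[OF True] q_rational_gt_1 c c' Mq_add_one mat22_mult One_fract_def
       del: Mq.simps)
qed

lemma q_rational_0: "q_rational 0 = 0"
proof -
  have "is_hj_expansion 2 [2]" by (simp add: is_hj_expansion_def)
  then have e: "hj_expansion 2 = [2]" by (rule hj_expansion_eqI)
  have "q_rational 2 = Fraction_Field.Fract (qv + 1) 1"
    by (simp add: q_rational_gt_1 e numeral_2_eq_2 Mq_add_one mat22_mult mat_pow_def mat_def qv_mult_inv
        del: One_nat_def)
  moreover have "q_rational 2 = Fraction_Field.Fract qv 1 * q_rational 1 + 1"
    using q_rational_add_1[of 1] by simp
  moreover have "Fraction_Field.Fract (qv + 1) 1 = Fraction_Field.Fract qv 1 + 1" by (simp add: One_fract_def)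
  moreover have "q_rational 1 = Fraction_Field.Fract qv 1 * q_rational 0 + 1"
    using q_rational_add_1[of 0] by simp
  moreover have "Fraction_Field.Fract qv 1 \<noteq> 0" by (simp add: Zero_fract_def eq_fract)
  ultimately show ?thesis by simp
qed

lemma is_q_fraction_gt_1:
  assumes "x > 1"
  shows "\<exists>Q. laurent_of_poly Q = Mq (hj_expansion x) $ 2 $ 1 \<and>
     is_q_fraction x (Mq (hj_expansion x) $ 1 $ 1) Q"
proof -
  obtain Q where "Mq (hj_expansion x) $ 2 $ 1 = laurent_of_poly Q" "poly Q 0 = 1"
    using Mq_poly[of "hj_expansion x"] hj_expansion[OF assms] by (auto simp: is_hj_expansion_def)
  then show ?thesis using Mq_coprime[of "hj_expansion x"]
    by (auto simp: is_q_fraction_def q_rational_gt_1[OF assms])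
qed

lemma is_q_fraction_exists: "\<exists>P Q. is_q_fraction x P Q"
proof (induction x rule: q_rational.induct)
  case (1 x)
  show ?case
  proof (cases "x > 1")
    case True
    then show ?thesis using is_q_fraction_gt_1 by blast
  next
    case False
    then obtain P Q where PQ: "is_q_fraction (x + 1) P Q" using 1 by blast
    have nz: "laurent_of_poly Q \<noteq> 0"
      using PQ laurent_of_poly_inject[of Q 0] by (auto simp: is_q_fraction_def)
    let ?P = "qv_inv * (P - laurent_of_poly Q)"
    have P: "P = qv * ?P + laurent_of_poly Q" by (simp add: qv_mult_inv flip: mult.assoc)
    have "laurent_coprime ?P (laurent_of_poly Q)"
      unfolding laurent_coprime_def
    proof (intro allI impI)
      fix c assume c: "c dvd ?P" "c dvd laurent_of_poly Q"
      then have "c dvd qv * ?P + laurent_of_poly Q" by (meson dvd_add dvd_mult)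
      then show "c dvd 1" using c PQ P by (auto simp: is_q_fraction_def laurent_coprime_def)
    qed
    moreover have "q_rational x = Fraction_Field.Fract ?P (laurent_of_poly Q)"
    proof -
      have q0: "Fraction_Field.Fract qv 1 \<noteq> 0" by (simp add: Zero_fract_def eq_fract)
      have "Fraction_Field.Fract qv 1 * q_rational x + 1 = Fraction_Field.Fract P (laurent_of_poly Q)"
        using PQ q_rational_add_1[of x] by (simp add: is_q_fraction_def)
      also have "\<dots> = Fraction_Field.Fract qv 1 * Fraction_Field.Fract ?P (laurent_of_poly Q) + 1"
        using nz P by (simp add: One_fract_def)
      finally show ?thesis using q0 by (metis add_right_imp_eq mult_left_cancel)
    qed
    ultimately show ?thesis using PQ by (auto simp: is_q_fraction_def)
  qed
qed

lemma is_q_fraction_q_numer_denom: "is_q_fraction x (q_numer x) (q_denom x)"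
proof -
  obtain P Q where PQ: "is_q_fraction x P Q" using is_q_fraction_exists by blast
  have "q_numer x = P" "q_denom x = Q"
    unfolding q_numer_def q_denom_def using PQ is_q_fraction_unique by blast+
  then show ?thesis using PQ by simp
qed

lemma q_numer_denom_gt_1:
  assumes "x > 1"
  shows "q_numer x = Mq (hj_expansion x) $ 1 $ 1"
    and "laurent_of_poly (q_denom x) = Mq (hj_expansion x) $ 2 $ 1"
  using is_q_fraction_gt_1[OF assms] is_q_fraction_unique is_q_fraction_q_numer_denom by metis+


section \<open>Cyclotomic polynomials\<close>

definition complex_cyclotomic :: "nat \<Rightarrow> complex poly" where
  "complex_cyclotomic d =
     (\<Prod>k\<in>totatives d. [:- cis (2 * pi * real k / real d), 1:])"

definition cyclotomic :: "nat \<Rightarrow> int poly" where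
  "cyclotomic d = (THE p. map_poly of_int p = complex_cyclotomic d)"


lemma degree_map_poly_of_int:
  "degree (map_poly of_int p :: 'a::{comm_ring_1, ring_char_0} poly) = degree p"
  by (cases "p = 0") (simp_all add: map_poly_degree_eq)

lemma monic_dvd_of_int:
  fixes f g :: "int poly" and h :: "complex poly"
  assumes "lead_coeff g = 1" "map_poly of_int f = map_poly of_int g * h"
  shows "\<exists>p. h = map_poly of_int p"
proof -
  obtain p r where pr: "pseudo_divmod f g = (p, r)" by fastforce
  have g0: "g \<noteq> 0" using assms(1) by auto
  have fg: "f = g * p + r" "r = 0 \<or> degree r < degree g"
    using pseudo_divmod[OF g0 pr] assms(1) by simp_all
  let ?m = "map_poly of_int :: int poly \<Rightarrow> complex poly"
  have hom: "?m (a * b) = ?m a * ?m b" "?m (a + b) = ?m a + ?m b" for a b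
    by (auto intro!: poly_eqI simp: coeff_map_poly coeff_mult)
  have deg: "degree (?m a) = degree a" for a by (rule degree_map_poly_of_int)
  have mg0: "?m g \<noteq> 0" using g0 by (metis map_poly_eq_0_iff of_int_0 of_int_eq_0_iff)
  have eq: "?m r = ?m g * (h - ?m p)"
    using assms(2) unfolding fg(1) hom by (simp add: algebra_simps)
  have "h - ?m p = 0"
  proof (rule ccontr)
    assume ne: "h - ?m p \<noteq> 0"
    then have "degree (?m r) \<ge> degree (?m g)" using eq mg0 by (simp add: degree_mult_eq)
    moreover have "r \<noteq> 0" using eq ne mg0 by auto
    ultimately show False using fg(2) deg by simp
  qed
  then show ?thesis by auto
qed

lemma prod_roots_unity:
  assumes "n > 0"
  shows "(\<Prod>k\<in>{0<..n}. [:- cis (2 * pi * real k / real n), 1:]) = monom 1 n - 1"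
proof -
  let ?w = "\<lambda>k. cis (2 * pi * real k / real n)" and ?p = "monom 1 n - 1 :: complex poly"
  have lead: "degree ?p = n" "lead_coeff ?p = 1"
  proof -
    have "coeff ?p n = 1" using assms by simp
    moreover have "degree ?p \<le> n" by (intro degree_diff_le degree_monom_le) simp
    ultimately show "degree ?p = n" by (metis le_antisym le_degree zero_neq_one)
    then show "lead_coeff ?p = 1" using assms by simp
  qed
  have p0: "?p \<noteq> 0" using lead assms by force
  have ord: "Polynomial.order z ?p = 1" if "poly ?p z = 0" for z
  proof -
    have "z ^ n = 1" using that by (simp add: poly_monom)
    then have "z \<noteq> 0" using assms by (auto simp: power_0_left)
    then have "poly (pderiv ?p) z \<noteq> 0"
      using assms by (simp add: pderiv_diff pderiv_monom poly_monom)
    then show ?thesis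
      using order_pderiv2[of ?p z 0] p0 that
      by (metis One_nat_def order_0I order_root pderiv_0 poly_0)
  qed
  have "{0<..n} = insert n ({..<n} - {0})" using assms by auto
  then have "(\<Prod>k\<in>{0<..n}. [:- ?w k, 1:]) = [:- ?w n, 1:] * (\<Prod>k\<in>{..<n} - {0}. [:- ?w k, 1:])"
    by simp
  also have "\<dots> = [:- ?w 0, 1:] * (\<Prod>k\<in>{..<n} - {0}. [:- ?w k, 1:])" using assms by simp
  also have "\<dots> = (\<Prod>k\<in>{..<n}. [:- ?w k, 1:])"
    using assms by (subst (2) prod.remove[of _ 0]) auto
  also have "\<dots> = (\<Prod>z | z ^ n = 1. [:- z, 1:])"
    using prod.reindex_bij_betw[OF Complex.bij_betw_roots_unity[OF assms], of "\<lambda>z. [:- z, 1:]"] by simp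
  also have "\<dots> = (\<Prod>z | poly ?p z = 0. [:- z, 1:] ^ Polynomial.order z ?p)"
    by (intro prod.cong) (auto simp: ord poly_monom)
  also have "\<dots> = ?p"
    using complex_poly_decompose[of ?p] unfolding lead(2) by simp
  finally show ?thesis .
qed

lemma complex_cyclotomic_prod:
  assumes "n > 0"
  shows "(\<Prod>d | d dvd n. complex_cyclotomic d) = monom 1 n - 1"
proof -
  let ?w = "\<lambda>n k. cis (2 * pi * real k / real n)"
  let ?A = "\<lambda>d. {k \<in> {0<..n}. gcd k n = d}"
  have fin: "finite {d. d dvd n}" using assms by (rule finite_divisors_nat)
  have bij: "bij_betw (\<lambda>d. n div d) {d. d dvd n} {d. d dvd n}"
    using assms by (intro bij_betwI[where g = "\<lambda>d. n div d"]) auto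
  have "(\<Prod>d | d dvd n. complex_cyclotomic d) = (\<Prod>d | d dvd n. complex_cyclotomic (n div d))"
    using prod.reindex_bij_betw[OF bij, of complex_cyclotomic] by simp
  also have "\<dots> = (\<Prod>d | d dvd n. \<Prod>k\<in>?A d. [:- ?w n k, 1:])"
  proof (intro prod.cong refl)
    fix d assume "d \<in> {d. d dvd n}"
    then have d: "d dvd n" by simp
    then obtain e where e: "n = e * d" by (metis dvdE mult.commute)
    have "(\<Prod>k\<in>?A d. [:- ?w n k, 1:]) = (\<Prod>k\<in>totatives (n div d). [:- ?w n (k * d), 1:])"
      using prod.reindex_bij_betw[OF bij_betw_totatives_gcd_eq[OF d assms], of "\<lambda>k. [:- ?w n k, 1:]"]
      by simp
    also have "\<dots> = complex_cyclotomic (n div d)"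
      unfolding complex_cyclotomic_def using assms e by (intro prod.cong refl) (auto simp: mult.assoc)
    finally show "complex_cyclotomic (n div d) = (\<Prod>k\<in>?A d. [:- ?w n k, 1:])" by simp
  qed
  also have "\<dots> = (\<Prod>k\<in>(\<Union>d\<in>{d. d dvd n}. ?A d). [:- ?w n k, 1:])"
    using fin by (intro prod.UNION_disjoint[symmetric]) auto
  also have "(\<Union>d\<in>{d. d dvd n}. ?A d) = {0<..n}" by auto
  finally show ?thesis using prod_roots_unity[OF assms] by simp
qed

lemma complex_cyclotomic_int: "\<exists>p. map_poly of_int p = complex_cyclotomic d \<and> lead_coeff p = 1"
proof (induction d rule: less_induct)
  case (less n)
  let ?m = "map_poly of_int :: int poly \<Rightarrow> complex poly"
  have monic: "lead_coeff p = 1" if "?m p = complex_cyclotomic d" for p d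
  proof -
    have "lead_coeff (complex_cyclotomic d) = 1"
      unfolding complex_cyclotomic_def by (simp add: lead_coeff_prod)
    then show ?thesis
      unfolding that[symmetric] by (simp add: degree_map_poly_of_int coeff_map_poly)
  qed
  have "\<exists>p. ?m p = complex_cyclotomic n"
  proof (cases "n = 0")
    case True
    then show ?thesis by (intro exI[of _ 1]) (simp add: complex_cyclotomic_def)
  next
    case False
    let ?D = "{d. d dvd n} - {n}"
    have fin: "finite {d. d dvd n}" using False by (simp add: finite_divisors_nat)
    have "\<forall>d\<in>?D. \<exists>p. ?m p = complex_cyclotomic d \<and> lead_coeff p = 1"
      using less False by (metis DiffE dvd_imp_le insertI1 mem_Collect_eq nat_less_le neq0_conv)
    then obtain f where f: "\<And>d. d \<in> ?D \<Longrightarrow> ?m (f d) = complex_cyclotomic d"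
        "\<And>d. d \<in> ?D \<Longrightarrow> lead_coeff (f d) = 1" by metis
    have hom: "?m (a * b) = ?m a * ?m b" for a b
      by (rule poly_eqI) (simp add: coeff_map_poly coeff_mult)
    have "?m (prod f A) = (\<Prod>d\<in>A. ?m (f d))" for A
      by (induction A rule: infinite_finite_induct) (simp_all add: hom)
    then have mp: "?m (prod f ?D) = (\<Prod>d\<in>?D. complex_cyclotomic d)"
      using f(1) by simp
    have "lead_coeff (prod f ?D) = 1" using f(2) by (simp add: lead_coeff_prod)
    moreover have "?m (monom 1 n - 1) = ?m (prod f ?D) * complex_cyclotomic n"
    proof -
      have "?m (monom 1 n - 1) = monom 1 n - 1"
        by (rule poly_eqI) (auto simp: coeff_map_poly)
      also have "\<dots> = complex_cyclotomic n * (\<Prod>d\<in>?D. complex_cyclotomic d)"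
        using complex_cyclotomic_prod[of n] False fin by (simp add: prod.remove[of _ n])
      finally show ?thesis by (simp add: mp)
    qed
    ultimately show ?thesis using monic_dvd_of_int by metis
  qed
  then show ?case using monic by blast
qed

lemma of_int_cyclotomic: "map_poly of_int (cyclotomic d) = complex_cyclotomic d"
proof -
  obtain p where p: "map_poly of_int p = complex_cyclotomic d" using complex_cyclotomic_int by blast
  have "r = p" if "map_poly of_int r = complex_cyclotomic d" for r
    using that unfolding p[symmetric] by (simp add: poly_eq_iff coeff_map_poly)
  with p show ?thesis unfolding cyclotomic_def by (metis (mono_tags, lifting) theI)
qed


section \<open>The modular group\<close>

definition SL2Z :: "(int^2^2) monoid" where
  "SL2Z = \<lparr>carrier = {A. det A = 1}, mult = (**), one = mat 1\<rparr>"

definition PSL2Z :: "(int^2^2) set monoid" where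
  "PSL2Z = SL2Z Mod {mat 1, - mat 1}"

definition to_PSL2Z :: "int^2^2 \<Rightarrow> (int^2^2) set" where
  "to_PSL2Z A = {mat 1, - mat 1} #>\<^bsub>SL2Z\<^esub> A"

definition R_PSL :: "(int^2^2) set" where
  "R_PSL = to_PSL2Z (vector [vector [1, 1], vector [0, 1]])"

definition S_PSL :: "(int^2^2) set" where
  "S_PSL = to_PSL2Z (vector [vector [0, -1], vector [1, 0]])"

definition normal_closure :: "('a, 'b) monoid_scheme \<Rightarrow> 'a set \<Rightarrow> 'a set" where
  "normal_closure G X = \<Inter> {N. N \<lhd> G \<and> X \<subseteq> N}"

definition N_sub :: "nat \<Rightarrow> (int^2^2) set set" where
  "N_sub d = normal_closure PSL2Z {R_PSL [^]\<^bsub>PSL2Z\<^esub> d}"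

definition RN_sub :: "nat \<Rightarrow> (int^2^2) set set" where
  "RN_sub d = generate PSL2Z {R_PSL} <#>\<^bsub>PSL2Z\<^esub> N_sub d"

datatype proj_rat = Fin rat | Infty

fun mobius :: "int^2^2 \<Rightarrow> proj_rat \<Rightarrow> proj_rat" where
  "mobius A Infty =
     (if A $ 2 $ 1 = 0 then Infty else Fin (of_int (A $ 1 $ 1) / of_int (A $ 2 $ 1)))"
| "mobius A (Fin x) =
     (let n = of_int (A $ 1 $ 1) * x + of_int (A $ 1 $ 2);
          m = of_int (A $ 2 $ 1) * x + of_int (A $ 2 $ 2)
      in if m = 0 then Infty else Fin (n / m))"

text \<open>An element of \<open>PSL(2,\<int>)\<close> is a coset \<open>{A, -A}\<close>, both of whose members act alike.\<close>

definition PSL_act :: "(int^2^2) set \<Rightarrow> proj_rat \<Rightarrow> proj_rat" where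
  "PSL_act g z = the_elem ((\<lambda>A. mobius A z) ` g)"

lemma group_SL2Z: "group SL2Z"
proof (rule groupI)
  fix A assume A: "A \<in> carrier SL2Z"
  let ?B = "vector [vector [A $ 2 $ 2, - A $ 1 $ 2], vector [- A $ 2 $ 1, A $ 1 $ 1]] :: int^2^2"
  have "A $ 1 $ 1 * A $ 2 $ 2 - A $ 1 $ 2 * A $ 2 $ 1 = 1" using A by (simp add: SL2Z_def det_2)
  then have "?B ** A = mat 1" "det ?B = 1"
    by (simp_all add: vec_eq_iff forall_2 matrix_matrix_mult_def sum_2 mat_def det_2 algebra_simps)
  then show "\<exists>B\<in>carrier SL2Z. B \<otimes>\<^bsub>SL2Z\<^esub> A = \<one>\<^bsub>SL2Z\<^esub>"
    by (auto simp: SL2Z_def)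
qed (auto simp: SL2Z_def det_mul matrix_mul_assoc)

lemma minus_matrix_mult: "(- A) ** B = - (A ** B)" "A ** (- B) = - (A ** B)"
  for A B :: "int^2^2"
  by (simp_all add: vec_eq_iff matrix_matrix_mult_def sum_negf)

lemma normal_center_SL2Z: "{mat 1, - mat 1} \<lhd> SL2Z"
proof -
  interpret group SL2Z by (rule group_SL2Z)
  have "det (- mat 1 :: int^2^2) = 1" by (simp add: det_2 mat_def)
  then have sub: "subgroup {mat 1, - mat 1} SL2Z"
    by (intro subgroupI) (auto simp: SL2Z_def minus_matrix_mult intro!: inv_equality[unfolded SL2Z_def, simplified])
  have "x \<otimes>\<^bsub>SL2Z\<^esub> h \<otimes>\<^bsub>SL2Z\<^esub> inv\<^bsub>SL2Z\<^esub> x = h"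
    if "x \<in> carrier SL2Z" "h \<in> {mat 1, - mat 1}" for x h
  proof -
    have "x \<otimes>\<^bsub>SL2Z\<^esub> h = h \<otimes>\<^bsub>SL2Z\<^esub> x"
      using that(2) by (auto simp: SL2Z_def minus_matrix_mult)
    moreover have "h \<in> carrier SL2Z" using that(2) sub subgroup.mem_carrier by metis
    ultimately show ?thesis using that(1) by (simp add: m_assoc)
  qed
  then show ?thesis unfolding normal_inv_iff using sub by simp
qed

lemma to_PSL2Z_eq: "to_PSL2Z A = {A, - A}"
  by (auto simp: to_PSL2Z_def r_coset_def SL2Z_def minus_matrix_mult)

lemma carrier_PSL2Z: "carrier PSL2Z = to_PSL2Z ` {A. det A = 1}"
  by (auto simp: PSL2Z_def FactGroup_def RCOSETS_def to_PSL2Z_def SL2Z_def)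

lemma group_PSL2Z: "group PSL2Z"
  unfolding PSL2Z_def using normal_center_SL2Z by (rule normal.factorgroup_is_group)

lemma PSL_act_to_PSL2Z: "PSL_act (to_PSL2Z A) z = mobius A z"
proof -
  have "mobius (- A) z = mobius A z"
  proof (cases z)
    case (Fin x)
    have "- (of_int (A $ i $ 1)) * x + - of_int (A $ i $ 2) = - (of_int (A $ i $ 1) * x + of_int (A $ i $ 2))" for i
      by simp
    then show ?thesis unfolding Fin mobius.simps Let_def uminus_vec_def
      by (simp only: vec_lambda_beta of_int_minus neg_equal_0_iff_equal minus_divide_divide)
  qed simp
  then show ?thesis by (simp add: PSL_act_def to_PSL2Z_eq)
qed

end

(* At a primitive d-th root of unity z, the matrices R_q and S_q generate a quotient of the triangle
   group (2, 3, d), and the value of [r/s]_q is the image of infinity under the word that produces r/s.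
   Together with the antiholomorphic deformation of x -> - conj x this becomes an action of the Coxeter group of type
   (2, 3, d) by antilinear maps of C^2, and for z = exp(2 pi i / d) three quadratic forms on C^2
   transform like the simple roots. Tits' theorem on the geometric representation then says that a word
   fixes infinity only if it is equivalent, modulo the relations, to a word in the two reflections that
   fix infinity, i.e. if it represents an element of <R> N_d. Conversely such a word fixes infinity at
   every primitive d-th root of unity, so all factors of Phi_d divide the polynomial, and irreducibility
   of Phi_d is never used. The same theorem with d = infinity shows that the relations of the modular
   group hold for the deformed action. The numerator is treated by applying S. *)
theory Submission
  imports Defs
begin

section \<open>Coxeter groups and their geometric representation\<close>

text \<open>The last letter of \<open>alt s t k\<close> depends on the parity of \<open>k\<close>; the first is \<open>t\<close>, so that
  \<open>s # alt s t k = alt t s (Suc k)\<close>.\<close>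

fun alt :: "'a \<Rightarrow> 'a \<Rightarrow> nat \<Rightarrow> 'a list" where
  "alt s t 0 = []"
| "alt s t (Suc k) = t # alt t s k"

lemma length_alt [simp]: "length (alt s t k) = k"
  by (induction k arbitrary: s t) auto

lemma alt_add: "alt s t (j + k) = alt s t j @ (if even j then alt s t k else alt t s k)"
  by (induction j arbitrary: s t) auto

lemma set_alt: "set (alt s t k) \<subseteq> {s, t}"
  by (induction k arbitrary: s t) auto

lemma rev_alt: "rev (alt s t k) = (if even k then alt t s k else alt s t k)"
proof (induction k arbitrary: s t)
  case (Suc k)
  then show ?case using alt_add[of s t k 1] alt_add[of t s k 1] by auto
qed simp

text \<open>The dichotomy behind Tits' argument: one more letter of the pair either prolongs the
  alternation or repeats its last letter, where it cancels. After the empty word, a letter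
  \<open>s\<close> distinct from \<open>t\<close> would do neither.\<close>

lemma alt_snoc:
  assumes "r = s \<or> r = t" "k > 0"
  shows "alt s t k @ [r] = alt s t (Suc k) \<or> (\<exists>w. alt s t k = w @ [r])"
  using assms
proof (induction k arbitrary: s t)
  case (Suc k)
  show ?case
  proof (cases k)
    case 0
    with Suc.prems show ?thesis by auto
  next
    case (Suc j)
    then show ?thesis using Suc.IH[of t s] Suc.prems by (auto simp: Cons_eq_append_conv)
  qed
qed simp

text \<open>\<open>cheb c k\<close> is \<open>U\<^bsub>k-1\<^esub>(c / 2)\<close> for the Chebyshev polynomials \<open>U\<close> of the second kind.\<close>

fun cheb :: "real \<Rightarrow> nat \<Rightarrow> real" where
  "cheb c 0 = 0"
| "cheb c (Suc 0) = 1"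
| "cheb c (Suc (Suc k)) = c * cheb c (Suc k) - cheb c k"

lemma cheb_sin: "sin \<theta> * cheb (2 * cos \<theta>) k = sin (real k * \<theta>)"
proof (induction "2 * cos \<theta>" k rule: cheb.induct)
  case (3 k)
  have 1: "sin (real (Suc (Suc k)) * \<theta>) = sin (real (Suc k) * \<theta> + \<theta>)"
    "sin (real k * \<theta>) = sin (real (Suc k) * \<theta> - \<theta>)"
    by (simp_all add: algebra_simps)
  have "sin \<theta> * cheb (2 * cos \<theta>) (Suc (Suc k)) = 2 * cos \<theta> * sin (real (Suc k) * \<theta>) - sin (real k * \<theta>)"
    using 3 by (simp add: algebra_simps)
  also have "\<dots> = sin (real (Suc (Suc k)) * \<theta>)"
    unfolding 1 sin_add sin_diff by (simp add: algebra_simps)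
  finally show ?case .
qed simp_all

text \<open>This covers infinite order, where \<open>\<theta> = 0\<close> turns
  \<open>cheb_sin\<close> into 0 = 0.\<close>

lemma cheb_2: "cheb 2 k = real k"
  by (induction "2::real" k rule: cheb.induct) auto

text \<open>The entry \<open>m s t = 0\<close> stands for infinite order; the junk value \<open>pi / 0 = 0\<close> then gives the
  coefficient \<open>2 * cos 0 = 2\<close>, which is the right one.\<close>

locale coxeter =
  fixes m :: "'s::finite \<Rightarrow> 's \<Rightarrow> nat"
  assumes m_diag [simp]: "m s s = 1"
    and m_sym: "m s t = m t s"
    and m_off: "s \<noteq> t \<Longrightarrow> m s t \<noteq> 1"
begin

text \<open>Minus twice the Tits form -cos(pi / m). With functions on letters read as coordinates in
  the simple roots, \<open>root_refl s\<close> is the reflection in the root of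
  \<open>s\<close>.\<close>

definition cf :: "'s \<Rightarrow> 's \<Rightarrow> real" where
  "cf s t = 2 * cos (pi / real (m s t))"

definition root_refl :: "'s \<Rightarrow> ('s \<Rightarrow> real) \<Rightarrow> 's \<Rightarrow> real" where
  "root_refl s \<beta> = \<beta>(s := \<beta> s + (\<Sum>u\<in>UNIV. cf s u * \<beta> u))"

definition simple :: "'s \<Rightarrow> 's \<Rightarrow> real" where
  "simple s u = (if u = s then 1 else 0)"

abbreviation root_act :: "'s list \<Rightarrow> ('s \<Rightarrow> real) \<Rightarrow> 's \<Rightarrow> real" where
  "root_act \<equiv> fold root_refl"

text \<open>Equality in the Coxeter group. As the letters are involutions, reversal of words serves
  as inversion; infinite order, coded by 0, contributes no braid relation.\<close>

inductive cox_eq :: "'s list \<Rightarrow> 's list \<Rightarrow> bool" where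
  refl [simp]: "cox_eq w w"
| sym: "cox_eq v w \<Longrightarrow> cox_eq w v"
| trans [trans]: "cox_eq u v \<Longrightarrow> cox_eq v w \<Longrightarrow> cox_eq u w"
| cancel: "cox_eq (u @ [s, s] @ v) (u @ v)"
| braid: "s \<noteq> t \<Longrightarrow> m s t > 0 \<Longrightarrow> cox_eq (u @ alt s t (m s t) @ v) (u @ alt t s (m s t) @ v)"

definition reduced :: "'s list \<Rightarrow> bool" where
  "reduced w \<longleftrightarrow> (\<forall>w'. cox_eq w w' \<longrightarrow> length w \<le> length w')"

lemma sum_mult_simple:
  fixes f :: "'s \<Rightarrow> real"
  shows "(\<Sum>u\<in>UNIV. f u * simple s u) = f s" "(\<Sum>u\<in>UNIV. simple s u * f u) = f s"
  by (subst sum.remove[of _ s]; simp add: simple_def sum.neutral)+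

lemma cf_sym: "cf s t = cf t s"
  by (simp add: cf_def m_sym)

lemma cf_diag [simp]: "cf s s = - 2"
  by (simp add: cf_def)

section \<open>Words modulo the Coxeter relations and reduced words\<close>

lemma cox_eq_context:
  assumes "cox_eq w w'"
  shows "cox_eq (u @ w @ v) (u @ w' @ v)"
  using assms
proof induction
  case (sym w w')
  from sym.IH show ?case by (rule cox_eq.sym)
next
  case (trans w w' w'')
  from trans.IH show ?case by (rule cox_eq.trans)
next
  case (cancel u' s v')
  show ?case using cox_eq.cancel[of "u @ u'" s "v' @ v"] by simp
next
  case (braid s t u' v')
  then show ?case using cox_eq.braid[of s t "u @ u'" "v' @ v"] by simp
qed simp

lemma cox_eq_append: "cox_eq u u' \<Longrightarrow> cox_eq v v' \<Longrightarrow> cox_eq (u @ v) (u' @ v')"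
  using cox_eq_context[of u u' "[]" v] cox_eq_context[of v v' u' "[]"] trans[of "u @ v" "u' @ v"] by simp

lemma cox_eq_Cons: "cox_eq u v \<Longrightarrow> cox_eq (s # u) (s # v)"
  using cox_eq_context[of u v "[s]" "[]"] by simp

lemma cox_eq_cancel_Cons: "cox_eq (s # s # v) v"
  using cancel[of "[]" s v] by simp

text \<open>The sign character of the Coxeter group; on mirror words it becomes the
  determinant.\<close>

lemma cox_eq_parity: "cox_eq w w' \<Longrightarrow> even (length w) = even (length w')"
  by (induction rule: cox_eq.induct) auto

lemma cox_eq_rev_cancel: "cox_eq (rev w @ w) []"
proof (induction w)
  case (Cons s w)
  have "cox_eq (rev (s # w) @ s # w) (rev w @ w)"
    using cancel[of "rev w" s w] by simp
  from this Cons show ?case by (rule trans)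
qed simp

lemma cox_eq_cancel_rev: "cox_eq (w @ rev w) []"
  using cox_eq_rev_cancel[of "rev w"] by simp

lemma cox_eq_alt:
  assumes "s \<noteq> t" "m s t > 0"
  shows "cox_eq (alt s t (2 * m s t)) []"
proof -
  have "alt s t (2 * m s t) = alt s t (m s t) @ rev (alt t s (m s t))"
    using alt_add[of s t "m s t" "m s t"] by (simp add: rev_alt mult_2)
  also have "cox_eq \<dots> (alt t s (m s t) @ rev (alt t s (m s t)))"
    using braid[OF assms, of "[]"] by simp
  also have "cox_eq \<dots> []" by (rule cox_eq_cancel_rev)
  finally show ?thesis .
qed

lemma reduced_appendD:
  assumes "reduced (u @ v)"
  shows "reduced u" "reduced v"
proof -
  show "reduced u" unfolding reduced_def
  proof (intro allI impI)
    fix w assume "cox_eq u w"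
    then have "cox_eq (u @ v) (w @ v)" by (intro cox_eq_append refl)
    then show "length u \<le> length w" using assms by (force simp: reduced_def)
  qed
  show "reduced v" unfolding reduced_def
  proof (intro allI impI)
    fix w assume "cox_eq v w"
    then have "cox_eq (u @ v) (u @ w)" by (intro cox_eq_append refl)
    then show "length v \<le> length w" using assms by (force simp: reduced_def)
  qed
qed

lemma reduced_cong: "reduced w \<Longrightarrow> cox_eq w w' \<Longrightarrow> length w' = length w \<Longrightarrow> reduced w'"
  using trans[of w w'] by (simp add: reduced_def)

lemma exists_reduced: "\<exists>w'. cox_eq w w' \<and> reduced w'"
proof -
  obtain w' where "cox_eq w w'" "\<forall>v. cox_eq w v \<longrightarrow> length w' \<le> length v"
    using ex_has_least_nat[of "cox_eq w" w length] by auto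
  then have "reduced w'" unfolding reduced_def using trans[OF \<open>cox_eq w w'\<close>] by simp
  with \<open>cox_eq w w'\<close> show ?thesis by blast
qed

text \<open>A shorter word for \<open>s # v\<close>, with \<open>s\<close> put in front again,
  represents \<open>v\<close>. Minimality of \<open>v\<close> and parity then fix its
  length.\<close>

lemma not_reduced_Cons:
  assumes "reduced v" "\<not> reduced (s # v)"
  shows "\<exists>u. cox_eq v (s # u) \<and> length v = Suc (length u)"
proof -
  obtain u where u: "cox_eq (s # v) u" "length u < Suc (length v)"
    using assms(2) by (auto simp: reduced_def not_le)
  have "cox_eq v (s # s # v)" by (rule sym[OF cox_eq_cancel_Cons])
  also have "cox_eq (s # s # v) (s # u)" using u(1) by (rule cox_eq_Cons)
  finally have eq: "cox_eq v (s # u)" .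
  then have "length v \<le> Suc (length u)" using assms(1) by (auto simp: reduced_def)
  moreover have "even (length v) \<longleftrightarrow> even (Suc (length u))" using cox_eq_parity[OF eq] by simp
  ultimately have "length v = Suc (length u)"
    using u(2) by presburger
  with eq show ?thesis by blast
qed

section \<open>The geometric representation and its rank-two subgroups\<close>

lemma root_refl_linear:
  "root_refl s (\<lambda>u. x * \<beta> u + y * \<gamma> u) = (\<lambda>u. x * root_refl s \<beta> u + y * root_refl s \<gamma> u)"
proof -
  have "(\<Sum>u\<in>UNIV. cf s u * (x * \<beta> u + y * \<gamma> u)) =
      x * (\<Sum>u\<in>UNIV. cf s u * \<beta> u) + y * (\<Sum>u\<in>UNIV. cf s u * \<gamma> u)"
    by (simp add: sum_distrib_left algebra_simps flip: sum.distrib)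
  then show ?thesis by (auto simp: root_refl_def fun_eq_iff algebra_simps)
qed

lemma root_act_linear:
  "root_act w (\<lambda>u. x * \<beta> u + y * \<gamma> u) = (\<lambda>u. x * root_act w \<beta> u + y * root_act w \<gamma> u)"
  by (induction w arbitrary: \<beta> \<gamma>) (simp_all add: root_refl_linear)

lemma root_refl_simple:
  "root_refl t (simple s) = (\<lambda>u. 1 * simple s u + cf t s * simple t u)"
  unfolding root_refl_def sum_mult_simple by (auto simp: simple_def)

lemma root_refl_invol: "root_refl s (root_refl s \<beta>) = \<beta>"
proof -
  define S where "S = (\<Sum>u\<in>UNIV. cf s u * \<beta> u)"
  have eq: "root_refl s \<beta> = (\<lambda>u. 1 * \<beta> u + S * simple s u)"
    by (auto simp: root_refl_def S_def simple_def)
  have "root_refl s (root_refl s \<beta>) = (\<lambda>u. 1 * root_refl s \<beta> u + S * root_refl s (simple s) u)"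
    by (subst (1) eq) (rule root_refl_linear)
  then show ?thesis by (simp add: eq root_refl_simple)
qed

text \<open>The first letter \<open>t\<close> turns \<open>simple s\<close> into
  \<open>simple s\<close> plus a multiple of \<open>simple t\<close>. The next letter
  \<open>s\<close> negates the first summand, so it continues with two letters fewer and the
  opposite sign: this is the Chebyshev recursion.\<close>

lemma root_act_alt:
  assumes "s \<noteq> t"
  shows "root_act (alt s t k) (simple s) =
    (if even k then (\<lambda>u. cheb (cf s t) (Suc k) * simple s u + cheb (cf s t) k * simple t u)
     else (\<lambda>u. cheb (cf s t) k * simple s u + cheb (cf s t) (Suc k) * simple t u))"
  using assms
proof (induction k arbitrary: s t rule: less_induct)
  case (less k)
  consider "k = 0" | "k = 1" | j where "k = Suc (Suc j)"
    by (metis One_nat_def not0_implies_Suc)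
  then show ?case
  proof cases
    case 3
    have "root_act (alt s t k) (simple s) = root_act (alt t s (Suc j)) (\<lambda>u. 1 * simple s u + cf s t * simple t u)"
      by (simp add: 3 root_refl_simple cf_sym)
    also have "\<dots> = (\<lambda>u. 1 * root_act (alt t s (Suc j)) (simple s) u + cf s t * root_act (alt t s (Suc j)) (simple t) u)"
      by (rule root_act_linear)
    also have "root_act (alt t s (Suc j)) (simple s) = root_act (alt s t j) (\<lambda>u. (- 1) * simple s u + 0 * simple s u)"
      by (simp add: root_refl_simple)
    also have "\<dots> = (\<lambda>u. - 1 * root_act (alt s t j) (simple s) u + 0 * root_act (alt s t j) (simple s) u)"
      by (rule root_act_linear)
    finally show ?thesis
      using less.IH[of j s t] less.IH[of "Suc j" t s] less.prems
      by (auto simp: 3 fun_eq_iff cf_sym[of t s] algebra_simps simp del: alt.simps)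
  qed (simp_all add: root_refl_simple cf_sym)
qed

text \<open>Everything is read off sin(k \<theta>) / sin \<theta> with
  \<open>\<theta> = pi / m s t\<close>. The first three values give the braid relation, the bound
  makes the form on the plane of the two roots nondegenerate, and the last fact gives positivity of
  roots.\<close>

lemma cf_cheb:
  assumes "s \<noteq> t" "m s t > 0"
  shows "cheb (cf s t) (m s t) = 0" "cheb (cf s t) (Suc (m s t)) = - 1"
    "cheb (cf s t) (m s t - 1) = 1" "\<bar>cf s t\<bar> < 2"
    "k \<le> m s t \<Longrightarrow> cheb (cf s t) k \<ge> 0"
proof -
  define M where "M = m s t"
  define \<theta> where "\<theta> = pi / M"
  have M: "M \<ge> 2" using m_off[OF assms(1)] assms(2) by (simp add: M_def)
  have th: "0 < \<theta>" "\<theta> < pi" using M by (simp_all add: \<theta>_def divide_less_eq)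
  have s0: "sin \<theta> > 0" using th by (rule sin_gt_zero)
  have Mth: "real M * \<theta> = pi" using M by (simp add: \<theta>_def)
  have c: "cf s t = 2 * cos \<theta>" by (simp add: cf_def M_def \<theta>_def)
  have U: "cheb (cf s t) k = sin (real k * \<theta>) / sin \<theta>" for k
    using cheb_sin[of \<theta> k] s0 by (simp add: c field_simps)
  show "cheb (cf s t) (m s t) = 0" by (simp add: U Mth flip: M_def)
  have "sin (real (Suc M) * \<theta>) = sin (\<theta> + pi)" using Mth by (simp add: algebra_simps)
  then show "cheb (cf s t) (Suc (m s t)) = - 1" using s0 by (simp add: U del: of_nat_Suc flip: M_def)
  have "real (M - 1) * \<theta> = pi - \<theta>" using Mth M by (simp add: algebra_simps of_nat_diff)
  then show "cheb (cf s t) (m s t - 1) = 1" using s0 by (simp add: U flip: M_def)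
  have "(sin \<theta>)\<^sup>2 > 0" using s0 by simp
  then have "(cos \<theta>)\<^sup>2 < 1" using sin_cos_squared_add[of \<theta>] by linarith
  then have "\<bar>cos \<theta>\<bar> < 1" using abs_square_less_1 by blast
  then show "\<bar>cf s t\<bar> < 2" by (simp add: c abs_mult)
  assume "k \<le> m s t"
  then have "real k * \<theta> \<le> real M * \<theta>" using th by (intro mult_right_mono) (simp_all add: M_def)
  then have "real k * \<theta> \<le> pi" by (simp only: Mth)
  then show "cheb (cf s t) k \<ge> 0" using th s0 by (simp add: U sin_ge_zero)
qed

text \<open>The vector \<open>\<beta>\<close> splits into a part fixed by both reflections and a
  part in the plane of the two roots, where the Chebyshev values decide.\<close>

lemma root_act_braid:
  assumes "s \<noteq> t" "m s t > 0"
  shows "root_act (alt s t (m s t)) \<beta> = root_act (alt t s (m s t)) \<beta>"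
proof -
  have simple: "root_act (alt s t (m s t)) (simple s) = root_act (alt t s (m s t)) (simple s)"
    if st: "s \<noteq> t" and m0: "m s t > 0" for s t
  proof -
    obtain j where j: "m s t = Suc j" using m0 by (cases "m s t") auto
    have "root_act (alt t s (m s t)) (simple s) = root_act (alt s t j) (\<lambda>u. (- 1) * simple s u + 0 * simple s u)"
      by (simp add: root_refl_simple j)
    also have "\<dots> = (\<lambda>u. - 1 * root_act (alt s t j) (simple s) u + 0 * root_act (alt s t j) (simple s) u)"
      by (rule root_act_linear)
    finally show ?thesis
      using cf_cheb(1-3)[OF st m0] st
      by (auto simp: root_act_alt fun_eq_iff j simp del: cheb.simps alt.simps)
  qed
  define A where "A = (\<Sum>u\<in>UNIV. cf s u * \<beta> u)"
  define B where "B = (\<Sum>u\<in>UNIV. cf t u * \<beta> u)"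
  define c where "c = cf s t"
  define D where "D = 4 - c * c"
  have "\<bar>c\<bar> * \<bar>c\<bar> < 2 * 2" using cf_cheb(4)[OF assms] unfolding c_def by (intro mult_strict_mono) auto
  then have D: "D \<noteq> 0" by (simp add: D_def)
  \<comment> \<open>The coefficients solve the two linear equations that make
    \<open>\<gamma>\<close> orthogonal to both roots; \<open>D\<close> is the determinant of that
    system.\<close>
  define x where "x = (2 * A + c * B) / D"
  define y where "y = (2 * B + c * A) / D"
  define \<gamma> where "\<gamma> u = \<beta> u + (x * simple s u + y * simple t u)" for u
  have ex: "(\<Sum>u\<in>UNIV. cf r u * \<gamma> u) = (\<Sum>u\<in>UNIV. cf r u * \<beta> u) + x * cf r s + y * cf r t" for r
  proof -
    have "(\<Sum>u\<in>UNIV. cf r u * \<gamma> u) = (\<Sum>u\<in>UNIV. cf r u * \<beta> u) +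
        x * (\<Sum>u\<in>UNIV. cf r u * simple s u) + y * (\<Sum>u\<in>UNIV. cf r u * simple t u)"
      by (simp add: \<gamma>_def algebra_simps sum.distrib sum_distrib_left)
    then show ?thesis by (simp add: sum_mult_simple)
  qed
  have "(\<Sum>u\<in>UNIV. cf s u * \<gamma> u) = 0" "(\<Sum>u\<in>UNIV. cf t u * \<gamma> u) = 0"
    unfolding ex using D
    by (simp_all add: cf_sym[of t s] flip: A_def B_def c_def)
      (simp_all add: x_def y_def field_simps, simp_all add: D_def algebra_simps)
  then have fix1: "root_refl s \<gamma> = \<gamma>" "root_refl t \<gamma> = \<gamma>" by (simp_all add: root_refl_def)
  have fix2: "root_act w \<gamma> = \<gamma>" if "set w \<subseteq> {s, t}" for w
    using that by (induction w) (auto simp: fix1)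
  define \<pi> where "\<pi> = (\<lambda>u. x * simple s u + y * simple t u)"
  have plane: "root_act (alt s t (m s t)) \<pi> = root_act (alt t s (m s t)) \<pi>"
    using simple[of s t] simple[of t s] assms by (simp add: \<pi>_def root_act_linear m_sym[of t s])
  have b: "\<beta> = (\<lambda>u. 1 * \<gamma> u + (- 1) * \<pi> u)"
    by (simp add: \<gamma>_def \<pi>_def)
  have "root_act (alt s t (m s t)) \<gamma> = root_act (alt t s (m s t)) \<gamma>"
    using fix2[of "alt s t (m s t)"] fix2[of "alt t s (m s t)"] set_alt[of s t] set_alt[of t s]
    by (simp add: insert_commute)
  then show ?thesis
    unfolding b root_act_linear by (simp only: plane)
qed

lemma root_act_cong: "cox_eq w w' \<Longrightarrow> root_act w \<beta> = root_act w' \<beta>"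
proof (induction arbitrary: \<beta> rule: cox_eq.induct)
  case (braid s t u v)
  then show ?case using root_act_braid[of s t "root_act u \<beta>"] by simp
qed (simp_all add: root_refl_invol)

section \<open>Positivity of roots and stabilisers of chamber points\<close>

text \<open>Tits' argument: split off the longest alternating prefix of \<open>w\<close> in \<open>s\<close> and its first letter
  \<open>t\<close>. The rest is reduced after both \<open>s\<close> and \<open>t\<close>, and the prefix maps \<open>simple s\<close> into the cone spanned by
  \<open>simple s\<close> and \<open>simple t\<close>.\<close>

lemma reduced_imp_positive_root:
  "reduced (s # w) \<Longrightarrow> root_act w (simple s) u \<ge> 0"
proof (induction "length w" arbitrary: w s u rule: less_induct)
  case less
  show ?case
  proof (cases w)
    case Nil
    then show ?thesis by (simp add: simple_def)
  next
    case (Cons t w1)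
    have rw: "reduced w" using reduced_appendD(2)[of "[s]" w] less.prems by simp
    have st: "s \<noteq> t"
    proof
      assume "s = t"
      then have "cox_eq (s # w) w1" using Cons cox_eq_cancel_Cons by simp
      then show False using less.prems by (force simp: reduced_def Cons)
    qed
    define P where "P k \<longleftrightarrow> (\<exists>v. cox_eq w (alt s t k @ v) \<and> k + length v = length w)" for k
    have "P 1" unfolding P_def by (rule exI[of _ w1]) (simp add: Cons)
    moreover have "\<forall>k. P k \<longrightarrow> k < Suc (length w)" by (auto simp: P_def)
    ultimately obtain k where k: "P k" "\<And>j. P j \<Longrightarrow> j \<le> k"
      using ex_has_greatest_nat[of P 1 "\<lambda>k. k" "Suc (length w)"] by blast
    have k0: "k > 0" using k(2)[OF \<open>P 1\<close>] by simp
    obtain v where v: "cox_eq w (alt s t k @ v)" "k + length v = length w"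
      using k(1) by (auto simp: P_def)
    have red: "reduced (s # alt s t k @ v)"
      using reduced_cong[OF less.prems cox_eq_Cons[OF v(1)]] v(2) by simp
    have rv: "reduced v" using reduced_appendD(2)[of "s # alt s t k" v] red by simp
    have rvr: "reduced (r # v)" if r: "r = s \<or> r = t" for r
    proof (rule ccontr)
      assume "\<not> reduced (r # v)"
      then obtain x where x: "cox_eq v (r # x)" "length v = Suc (length x)"
        using not_reduced_Cons[OF rv] by blast
      have wx: "cox_eq w (alt s t k @ r # x)"
        by (rule trans[OF v(1) cox_eq_append[OF refl x(1)]])
      consider "alt s t k @ [r] = alt s t (Suc k)" | y where "alt s t k = y @ [r]"
        using alt_snoc[OF r k0] by blast
      then show False
      proof cases
        case 1
        have "alt s t k @ r # x = alt s t (Suc k) @ x" unfolding 1[symmetric] by simp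
        with wx have "cox_eq w (alt s t (Suc k) @ x)" by metis
        then have "P (Suc k)" unfolding P_def
          using v(2) x(2) by (intro exI[of _ x]) (simp del: alt.simps)
        then show False using k(2)[of "Suc k"] by simp
      next
        case 2
        have "cox_eq w (y @ x)"
          using trans[OF wx] cancel[of y r x] by (simp add: 2)
        then have "length w \<le> length (y @ x)" using rw by (auto simp: reduced_def)
        moreover have "k = Suc (length y)" using arg_cong[OF 2, of length] by simp
        ultimately show False using v(2) x(2) by simp
      qed
    qed
    \<comment> \<open>At length \<open>m s t\<close> the braid relation would let the prefix begin
      with \<open>s\<close>, which cancels the \<open>s\<close> in front and contradicts
      reducedness.\<close>
    have km: "k < m s t" if m0: "m s t > 0"
    proof (rule ccontr)
      assume "\<not> k < m s t"
      then obtain y where y: "alt s t k = alt s t (m s t) @ y"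
        using alt_add[of s t "m s t" "k - m s t"] by (metis le_add_diff_inverse not_le)
      obtain j where j: "m s t = Suc j" using m0 by (cases "m s t") auto
      have "cox_eq (s # alt s t k @ v) (s # alt t s (m s t) @ y @ v)"
        unfolding y using braid[OF st m0, of "[s]" "y @ v"] by simp
      also have "cox_eq (s # alt t s (m s t) @ y @ v) (alt s t j @ y @ v)"
        by (simp add: j cox_eq_cancel_Cons)
      finally have "length (s # alt s t k @ v) \<le> length (alt s t j @ y @ v)"
        using red unfolding reduced_def by blast
      then show False using arg_cong[OF y, of length] j by simp
    qed
    \<comment> \<open>By \<open>km\<close> the index \<open>Suc k\<close> is at most
      \<open>m s t\<close>, the range in which \<open>cf_cheb\<close> gives nonnegativity.\<close>
    have U: "cheb (cf s t) j \<ge> 0" if "j \<le> Suc k" for j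
    proof (cases "m s t = 0")
      case True
      then show ?thesis by (simp add: cf_def cheb_2)
    next
      case False
      then show ?thesis using cf_cheb(5)[OF st, of j] km that by auto
    qed
    have "root_act v (simple r) u \<ge> 0" if "r = s \<or> r = t" for r
      using less.hyps[of v r u] rvr[OF that] v(2) k0 by simp
    then show ?thesis
      using U[of k] U[of "Suc k"]
      by (simp add: root_act_cong[OF v(1)] root_act_alt[OF st] root_act_linear del: cheb.simps)
  qed
qed

text \<open>For a reduced word \<open>s # u\<close>, positivity of the root gives
  \<open>\<alpha> s \<ge> 0\<close> before the last reflection \<open>s\<close>, which changes its
  sign; hence the value is 0, \<open>s\<close> changes no coordinate, and induction continues with
  \<open>u\<close>. Only the values of \<open>\<alpha>\<close> enter, so the statement fits
  antilinear maps and quadratic forms.\<close>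

lemma chamber_stabilizer:
  fixes \<sigma> :: "'s \<Rightarrow> 'x \<Rightarrow> 'x" and \<alpha> :: "'s \<Rightarrow> 'x \<Rightarrow> real"
  assumes refl: "\<And>s t x. \<alpha> t (\<sigma> s x) = \<alpha> t x + cf s t * \<alpha> s x"
    and "\<And>t. \<alpha> t x \<ge> 0" "\<And>t. \<alpha> t (foldr \<sigma> w x) \<ge> 0"
  shows "\<exists>w'. cox_eq w w' \<and> set w' \<subseteq> {t. \<alpha> t (foldr \<sigma> w x) = 0}"
proof -
  have pair1: "(\<Sum>t\<in>UNIV. \<beta> t * \<alpha> t (\<sigma> s x)) = (\<Sum>t\<in>UNIV. root_refl s \<beta> t * \<alpha> t x)" for \<beta> s x
  proof -
    define A where "A = (\<Sum>t\<in>UNIV. cf s t * \<beta> t)"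
    have "root_refl s \<beta> t = \<beta> t + A * simple s t" for t
      by (simp add: root_refl_def simple_def A_def)
    moreover have "(\<Sum>t\<in>UNIV. A * simple s t * \<alpha> t x) = A * \<alpha> s x"
      using sum_mult_simple(2)[of s "\<lambda>t. A * \<alpha> t x"] by (simp add: mult_ac)
    ultimately show ?thesis
      by (simp add: refl algebra_simps sum.distrib)
        (simp add: A_def sum_distrib_left sum_distrib_right algebra_simps)
  qed
  \<comment> \<open>\<open>fold\<close> starts at the left end of the word and \<open>foldr\<close>
    at the right end, so the two actions are adjoint under this pairing.\<close>
  have pair: "(\<Sum>t\<in>UNIV. \<beta> t * \<alpha> t (foldr \<sigma> w x)) = (\<Sum>t\<in>UNIV. root_act w \<beta> t * \<alpha> t x)" for \<beta> w x
    by (induction w arbitrary: \<beta>) (simp_all add: pair1)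
  have val: "\<alpha> s (foldr \<sigma> w x) = (\<Sum>t\<in>UNIV. root_act w (simple s) t * \<alpha> t x)" for s w x
    using pair[of "simple s" w x] by (simp add: sum_mult_simple)
  show ?thesis
    using assms(3)
  proof (induction "length w" arbitrary: w rule: less_induct)
    case less
    obtain w1 where w1: "cox_eq w w1" "reduced w1" using exists_reduced by blast
    then have len: "length w1 \<le> length w" using sym[of w w1] unfolding reduced_def by simp
    have same: "\<alpha> t (foldr \<sigma> w x) = \<alpha> t (foldr \<sigma> w1 x)" for t
      by (simp add: val root_act_cong[OF w1(1)])
    show ?case
    proof (cases w1)
      case Nil
      then show ?thesis using w1(1) by (intro exI[of _ "[]"]) auto
    next
      case (Cons s u)
      have "\<alpha> s (foldr \<sigma> u x) \<ge> 0" unfolding val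
        using reduced_imp_positive_root[of s u] w1(2) assms(2) by (intro sum_nonneg) (simp add: Cons)
      moreover have "\<alpha> s (foldr \<sigma> w1 x) = - \<alpha> s (foldr \<sigma> u x)" by (simp add: Cons refl)
      ultimately have z: "\<alpha> s (foldr \<sigma> u x) = 0" "\<alpha> s (foldr \<sigma> w x) = 0"
        using less.prems[of s] by (simp_all add: same)
      then have u: "\<alpha> t (foldr \<sigma> w x) = \<alpha> t (foldr \<sigma> u x)" for t
        unfolding same by (simp add: Cons refl)
      obtain u' where u': "cox_eq u u'" "set u' \<subseteq> {t. \<alpha> t (foldr \<sigma> u x) = 0}"
        using less.hyps[of u] less.prems len by (auto simp: Cons u)
      have "cox_eq w (s # u')" using trans[OF w1(1)] cox_eq_Cons[OF u'(1)] by (simp add: Cons)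
      then show ?thesis using u'(2) z(2) by (intro exI[of _ "s # u'"]) (auto simp: u)
    qed
  qed
qed

end

section \<open>The triangle groups and their deformed action\<close>

datatype mirror = MA | MB | MC

instance mirror :: finite
proof
  have "(UNIV :: mirror set) = {MA, MB, MC}" using mirror.exhaust by auto
  then show "finite (UNIV :: mirror set)" by (metis finite.emptyI finite.insertI)
qed

fun tri_m :: "nat \<Rightarrow> mirror \<Rightarrow> mirror \<Rightarrow> nat" where
  "tri_m d MA MB = d"
| "tri_m d MB MA = d"
| "tri_m d MB MC = 3"
| "tri_m d MC MB = 3"
| "tri_m d MA MC = 2"
| "tri_m d MC MA = 2"
| "tri_m d s t = 1"

locale triangle =
  fixes d :: nat
  assumes d_neq_1: "d \<noteq> 1"

sublocale triangle \<subseteq> coxeter "tri_m d"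
proof
  fix s t :: mirror
  show "tri_m d s s = 1" by (cases s) auto
  show "tri_m d s t = tri_m d t s" by (cases s; cases t) auto
  show "s \<noteq> t \<Longrightarrow> tri_m d s t \<noteq> 1" using d_neq_1 by (cases s; cases t) auto
qed

text \<open>The group of type (2, 3, \<infinity>): the value 0 leaves \<open>MA\<close> and
  \<open>MB\<close> without a braid relation.\<close>

interpretation free: triangle 0
  by unfold_locales simp

text \<open>The maps x -> -x, x -> 1 - x and x -> 1/x. The words \<open>[MB, MA]\<close> and
  \<open>[MA, MC]\<close> give the matrices of \<open>R\<close> and \<open>S\<close>.\<close>

fun mirror_mat :: "mirror \<Rightarrow> int^2^2" where
  "mirror_mat MA = vector [vector [-1, 0], vector [0, 1]]"
| "mirror_mat MB = vector [vector [-1, 1], vector [0, 1]]"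
| "mirror_mat MC = vector [vector [0, 1], vector [1, 0]]"

definition word_mat :: "mirror list \<Rightarrow> int^2^2" where
  "word_mat w = foldr (\<lambda>s A. mirror_mat s ** A) w (mat 1)"

text \<open>For \<open>|z| = 1\<close> these are antilinear deformations of the three mirrors such that \<open>[MB, MA]\<close> and
  \<open>[MA, MC]\<close> act as the matrices \<open>Rq\<close> and \<open>Sq\<close> at \<open>q = z\<close>.\<close>

fun mirror_map :: "complex \<Rightarrow> mirror \<Rightarrow> complex \<times> complex \<Rightarrow> complex \<times> complex" where
  "mirror_map z MA (x, y) = (- cnj z * cnj x, cnj y)"
| "mirror_map z MB (x, y) = (cnj y - cnj x, cnj y)"
| "mirror_map z MC (x, y) = (cnj y, cnj x)"

abbreviation word_map :: "complex \<Rightarrow> mirror list \<Rightarrow> complex \<times> complex \<Rightarrow> complex \<times> complex" where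
  "word_map z \<equiv> foldr (mirror_map z)"

section \<open>Mirror words as integer matrices\<close>

lemma mat22_eqI:
  fixes A B :: "'a^2^2"
  assumes "A $ 1 $ 1 = B $ 1 $ 1" "A $ 1 $ 2 = B $ 1 $ 2" "A $ 2 $ 1 = B $ 2 $ 1" "A $ 2 $ 2 = B $ 2 $ 2"
  shows "A = B"
  using assms by (simp add: vec_eq_iff forall_2)

lemma mat_1_entries [simp]:
  "(mat 1 :: 'a::{zero,one}^2^2) $ 1 $ 1 = 1" "(mat 1 :: 'a^2^2) $ 1 $ 2 = 0"
  "(mat 1 :: 'a^2^2) $ 2 $ 1 = 0" "(mat 1 :: 'a^2^2) $ 2 $ 2 = 1"
  by (simp_all add: mat_def)

lemma word_mat_Nil [simp]: "word_mat [] = mat 1"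
  by (simp add: word_mat_def)

lemma word_mat_Cons [simp]: "word_mat (s # w) = mirror_mat s ** word_mat w"
  by (simp add: word_mat_def)

lemma word_mat_append: "word_mat (u @ v) = word_mat u ** word_mat v"
  by (induction u) (simp_all add: matrix_mul_assoc)

lemma mirror_mat_square: "mirror_mat s ** mirror_mat s = mat 1"
  by (cases s) (auto intro!: mat22_eqI simp: mat22_mult)

lemma word_mat_rev: "word_mat (rev w) ** word_mat w = mat 1" "word_mat w ** word_mat (rev w) = mat 1"
proof -
  show 1: "word_mat (rev w) ** word_mat w = mat 1" for w
  proof (induction w)
    case (Cons s w)
    have "word_mat (rev (s # w)) ** word_mat (s # w) =
        word_mat (rev w) ** (mirror_mat s ** mirror_mat s) ** word_mat w"
      by (simp add: word_mat_append matrix_mul_assoc)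
    with Cons show ?case by (simp add: mirror_mat_square)
  qed simp
  show "word_mat w ** word_mat (rev w) = mat 1" using 1[of "rev w"] by simp
qed

lemma det_mirror_mat: "det (mirror_mat s) = -1"
  by (cases s) (simp_all add: det_2)

lemma det_word_mat: "det (word_mat w) = (-1) ^ length w"
  by (induction w) (simp_all add: det_mul det_mirror_mat)

lemma det_word_mat_even: "det (word_mat w) = 1 \<longleftrightarrow> even (length w)"
  by (simp add: det_word_mat minus_one_power_iff)

text \<open>A fixed word for the translation x -> x + k. Since \<open>alt\<close> begins with its
  second argument, \<open>alt MA MB 2\<close> is \<open>[MB, MA]\<close>, the word of
  \<open>R\<close>.\<close>

definition rot :: "int \<Rightarrow> mirror list" where
  "rot k = (if k \<ge> 0 then alt MA MB (2 * nat k) else alt MB MA (2 * nat (- k)))"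

lemma word_mat_alt:
  "word_mat (alt MA MB (2 * n)) = vector [vector [1, int n], vector [0, 1]]"
  "word_mat (alt MB MA (2 * n)) = vector [vector [1, - int n], vector [0, 1]]"
  by (induction n) (auto intro!: mat22_eqI simp: mat22_mult)

lemma word_mat_rot: "word_mat (rot k) = vector [vector [1, k], vector [0, 1]]"
  by (simp add: rot_def word_mat_alt)

lemma even_length_rot [simp]: "even (length (rot k))"
  by (simp add: rot_def)

lemma set_rot: "set (rot k) \<subseteq> {MA, MB}"
  using set_alt[of MA MB] set_alt[of MB MA] by (auto simp: rot_def)

lemma rot_step:
  "rot (k + 1) = MB # MA # rot k \<or> rot k = MA # MB # rot (k + 1)"
proof (cases "k \<ge> 0")
  case True
  then have "nat (k + 1) = Suc (nat k)" by simp
  then show ?thesis using True by (simp add: rot_def)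
next
  case False
  then have "nat (- k) = Suc (nat (- (k + 1)))" by simp
  then have "rot k = MA # MB # alt MB MA (2 * nat (- (k + 1)))" using False by (simp add: rot_def)
  moreover have "alt MB MA (2 * nat (- (k + 1))) = rot (k + 1)"
    using False by (cases "k = - 1") (auto simp: rot_def)
  ultimately show ?thesis by simp
qed

context triangle
begin

text \<open>Letters are taken in pairs: each pair cancels or moves the exponent of the translation
  by one.\<close>

lemma dihedral_word:
  assumes "set w \<subseteq> {MA, MB}" "even (length w)"
  shows "\<exists>k. cox_eq w (rot k)"
  using assms
proof (induction w rule: induct_list012)
  case 1
  then show ?case by (intro exI[of _ 0]) (simp add: rot_def)
next
  case (3 s t w)
  then obtain k where k: "cox_eq w (rot k)" by auto
  have "cox_eq (s # t # w) (s # t # rot k)" by (intro cox_eq_Cons k)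
  moreover have "\<exists>j. cox_eq (s # t # rot k) (rot j)"
  proof -
    have 1: "cox_eq (MB # MA # rot k) (rot (k + 1))"
    proof -
      have "cox_eq (MB # MA # MA # MB # rot (k + 1)) (MB # MB # rot (k + 1))"
        by (intro cox_eq_Cons cox_eq_cancel_Cons)
      also have "cox_eq (MB # MB # rot (k + 1)) (rot (k + 1))" by (rule cox_eq_cancel_Cons)
      finally show ?thesis using rot_step[of k] by auto
    qed
    have 2: "cox_eq (MA # MB # rot k) (rot (k - 1))"
    proof -
      have "cox_eq (MA # MB # MB # MA # rot (k - 1)) (MA # MA # rot (k - 1))"
        by (intro cox_eq_Cons cox_eq_cancel_Cons)
      also have "cox_eq (MA # MA # rot (k - 1)) (rot (k - 1))" by (rule cox_eq_cancel_Cons)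
      finally show ?thesis using rot_step[of "k - 1"] by auto
    qed
    show ?thesis using "3.prems"(1) 1 2 cox_eq_cancel_Cons[of _ "rot k"] by auto
  qed
  ultimately show ?case using trans by blast
qed auto

lemma cox_eq_mono:
  assumes "free.cox_eq w w'"
  shows "cox_eq w w'"
  using assms
proof (induction rule: free.cox_eq.induct)
  case (sym v w)
  from sym.IH show ?case by (rule cox_eq.sym)
next
  case (trans u v w)
  from trans.IH show ?case by (rule cox_eq.trans)
next
  case (cancel u s v)
  show ?case by (rule cox_eq.cancel)
next
  case (braid s t u v)
  then have "tri_m 0 s t = tri_m d s t" by (cases s; cases t) auto
  then show ?case using braid cox_eq.braid[of s t u v] by simp
qed simp

end

text \<open>The sign is unavoidable, since the two sides of each braid relation are negatives of
  each other as matrices.\<close>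

lemma free_cox_eq_word_mat:
  assumes "free.cox_eq w w'"
  shows "word_mat w' = word_mat w \<or> word_mat w' = - word_mat w"
  using assms
proof (induction rule: free.cox_eq.induct)
  case (cancel u s v)
  have "word_mat (u @ [s, s] @ v) = word_mat u ** (mirror_mat s ** mirror_mat s) ** word_mat v"
    by (simp add: word_mat_append matrix_mul_assoc)
  then show ?case by (simp add: mirror_mat_square word_mat_append)
next
  case (braid s t u v)
  have "word_mat (alt t s (tri_m 0 s t)) = - word_mat (alt s t (tri_m 0 s t))"
    using braid
    by (cases s; cases t) (auto intro!: mat22_eqI simp: mat22_mult eval_nat_numeral)
  then show ?case by (simp add: word_mat_append minus_matrix_mult)
qed auto

text \<open>With \<open>z = h\<^sup>2\<close>, the form of index \<open>s\<close> vanishes on the mirror of \<open>mirror_map z s\<close>; the three forms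
  are positive inside the fundamental triangle, one of whose vertices is the point \<open>\<infinity> = (1, 0)\<close>.\<close>

fun mirror_form :: "complex \<Rightarrow> mirror \<Rightarrow> complex \<times> complex \<Rightarrow> real" where
  "mirror_form h MA (x, y) = 2 * Re (h * x * cnj y)"
| "mirror_form h MB (x, y) = (cmod y)\<^sup>2 - 2 * Re (x * cnj y)"
| "mirror_form h MC (x, y) = (cmod x)\<^sup>2 - (cmod y)\<^sup>2"

section \<open>The fundamental triangle of the deformed action\<close>

context triangle
begin

text \<open>This is the hypothesis of \<open>chamber_stabilizer\<close>, an identity of polynomials
  in real and imaginary parts once \<open>cis\<close> is expressed by \<open>C\<close> and
  \<open>D\<close>. For \<open>d = 0\<close> the angle is 0, which gives the undeformed
  action.\<close>

lemma mirror_form_map: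
  "mirror_form (cis (pi / d)) t (mirror_map (cis (2 * (pi / d))) s v) =
     mirror_form (cis (pi / d)) t v + cf s t * mirror_form (cis (pi / d)) s v"
proof -
  obtain x y where v: "v = (x, y)" by (cases v)
  define \<theta> where "\<theta> = pi / real d"
  define C where "C = cos \<theta>"
  define D where "D = sin \<theta>"
  have CD: "C * C + D * D = 1" using sin_cos_squared_add[of \<theta>] by (simp add: C_def D_def power2_eq_square)
  have z: "cis (2 * \<theta>) = Complex (C * C - D * D) (2 * (C * D))"
    using cos_double[of \<theta>] sin_double[of \<theta>] by (simp add: complex_eq_iff C_def D_def power2_eq_square)
  have DD: "D * D = 1 - C * C" using CD by simp
  \<comment> \<open>A copy of \<open>DD\<close> for right-nested products, the shape that
    \<open>algebra_simps\<close> produces.\<close>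
  have DD': "D * (D * r) = r - C * (C * r)" for r
    using DD by (metis mult.assoc mult.left_neutral left_diff_distrib)
  have h: "cis \<theta> = Complex C D" by (simp add: complex_eq_iff C_def D_def)
  have sq: "(cmod a)\<^sup>2 = Re a * Re a + Im a * Im a" for a
    by (simp add: cmod_power2) (simp add: power2_eq_square)
  have cfs: "cf MA MB = 2 * C" "cf MB MA = 2 * C" "cf MA MC = 0" "cf MC MA = 0" "cf MB MC = 1" "cf MC MB = 1"
    by (simp_all add: cf_def C_def \<theta>_def cos_60)
  show ?thesis
    unfolding v \<theta>_def[symmetric] z h
    by (cases s; cases t)
      (simp_all add: cfs sq algebra_simps DD DD')
qed

lemma mirror_map_eq_0:
  assumes "z \<noteq> 0" "mirror_map z s v = (0, 0)"
  shows "v = (0, 0)"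
  using assms by (cases v; cases s) auto

lemma word_map_nonzero:
  assumes "z \<noteq> 0" "v \<noteq> (0, 0)"
  shows "word_map z w v \<noteq> (0, 0)"
proof (induction w)
  case (Cons s w)
  then show ?case using mirror_map_eq_0[OF assms(1), of s "word_map z w v"] by auto
qed (use assms in auto)

text \<open>On vectors \<open>(y, 0)\<close> the forms of \<open>MA\<close> and \<open>MB\<close>
  vanish and that of \<open>MC\<close> is |y|^2. So start and image both lie in the closed chamber,
  and only \<open>MA\<close> and \<open>MB\<close> can occur in the stabilising word.\<close>

lemma word_fixes_infinity:
  assumes "snd (word_map (cis (2 * (pi / d))) w (1, 0)) = 0"
  shows "\<exists>w'. cox_eq w w' \<and> set w' \<subseteq> {MA, MB}"
proof -
  define v where "v = word_map (cis (2 * (pi / d))) w (1, 0)"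
  define \<alpha> where "\<alpha> = mirror_form (cis (pi / d))"
  obtain x where v: "v = (x, 0)" using assms by (cases v) (auto simp: v_def)
  have x: "x \<noteq> 0"
    using word_map_nonzero[of "cis (2 * (pi / d))" "(1, 0)" w] v by (auto simp: v_def)
  have vals: "\<alpha> t (y, 0) = (if t = MC then (cmod y)\<^sup>2 else 0)" for t y
    by (cases t) (auto simp: \<alpha>_def)
  have "\<exists>w'. cox_eq w w' \<and> set w' \<subseteq> {t. \<alpha> t v = 0}"
    unfolding v_def
  proof (rule chamber_stabilizer)
    show "\<alpha> t (mirror_map (cis (2 * (pi / d))) s x) = \<alpha> t x + cf s t * \<alpha> s x" for s t x
      unfolding \<alpha>_def by (rule mirror_form_map)
    show "0 \<le> \<alpha> t (1, 0)" for t by (simp add: vals)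
    show "0 \<le> \<alpha> t (word_map (cis (2 * (pi / d))) w (1, 0))" for t
      unfolding v_def[symmetric] v by (simp add: vals)
  qed
  moreover have "{t. \<alpha> t v = 0} \<subseteq> {MA, MB}"
  proof
    fix t assume "t \<in> {t. \<alpha> t v = 0}"
    then show "t \<in> {MA, MB}" using x by (cases t) (auto simp: v vals)
  qed
  ultimately show ?thesis by blast
qed

end

text \<open>Conjugation is trivial on integers, so at \<open>z = 1\<close> the deformed maps
  restrict to the matrices.\<close>

lemma word_map_1:
  "word_map 1 w (of_int a, of_int b) =
    (of_int (word_mat w $ 1 $ 1 * a + word_mat w $ 1 $ 2 * b),
     of_int (word_mat w $ 2 $ 1 * a + word_mat w $ 2 $ 2 * b))"
proof (induction w)
  case (Cons s w)
  show ?case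
    unfolding foldr.simps o_apply Cons by (cases s) (simp_all add: mat22_mult algebra_simps)
qed simp

text \<open>This is the presentation of \<open>PGL(2, \<int>)\<close>: for \<open>d = 0\<close> the deformed action at \<open>z = 1\<close> is the
  original one, so the stabiliser theorem applies to it as well.\<close>

lemma free_faithful:
  assumes "word_mat w = mat 1 \<or> word_mat w = - mat 1"
  shows "free.cox_eq w []"
proof -
  have "word_mat w $ 2 $ 1 = 0" using assms by auto
  then have "snd (word_map (cis (2 * (pi / real 0))) w (1, 0)) = 0"
    using word_map_1[of w 1 0] by simp
  then obtain w' where w': "free.cox_eq w w'" "set w' \<subseteq> {MA, MB}"
    using free.word_fixes_infinity by blast
  \<comment> \<open>The determinant rules out odd dihedral words, which leaves a translation; the
    matrix then forces its exponent to be 0.\<close>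
  have "det (word_mat w) = 1" using assms by (auto simp: det_2)
  then have "even (length w')" using free.cox_eq_parity[OF w'(1)] by (simp add: det_word_mat_even)
  then obtain k where k: "free.cox_eq w' (rot k)" using free.dihedral_word w'(2) by blast
  have wk: "free.cox_eq w (rot k)" using w'(1) k by (rule free.trans)
  then have "word_mat (rot k) = mat 1 \<or> word_mat (rot k) = - mat 1"
    using free_cox_eq_word_mat[OF wk] assms by auto
  then have "k = 0" by (auto simp: word_mat_rot vec_eq_iff forall_2)
  with wk show ?thesis by (simp add: rot_def)
qed

text \<open>By faithfulness for \<open>d = 0\<close> the words agree modulo the relations of
  \<open>free\<close>, and these hold for every \<open>d\<close>.\<close>

lemma (in triangle) cox_eq_of_word_mat:
  assumes "word_mat u = word_mat v \<or> word_mat u = - word_mat v"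
  shows "cox_eq u v"
proof -
  have "word_mat (rev v @ u) = mat 1 \<or> word_mat (rev v @ u) = - mat 1"
    using assms word_mat_rev(1)[of v] by (auto simp: word_mat_append minus_matrix_mult)
  then have "cox_eq (rev v @ u) []" by (intro cox_eq_mono free_faithful)
  then have 1: "cox_eq (v @ rev v @ u) (v @ [])" by (intro cox_eq_append refl)
  have "cox_eq u (v @ rev v @ u)"
    using cox_eq_append[OF sym[OF cox_eq_cancel_rev[of v]] refl[of u]] by simp
  also note 1
  finally show ?thesis by simp
qed

section \<open>The deformed action on the complex projective line\<close>

definition proportional :: "complex \<times> complex \<Rightarrow> complex \<times> complex \<Rightarrow> bool" where
  "proportional u v \<longleftrightarrow> (\<exists>l. l \<noteq> 0 \<and> fst v = l * fst u \<and> snd v = l * snd u)"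

lemma proportional_refl [simp]: "proportional u u"
  unfolding proportional_def by (rule exI[of _ 1]) simp

lemma proportional_sym: "proportional u v \<Longrightarrow> proportional v u"
proof -
  assume "proportional u v"
  then obtain l where "l \<noteq> 0" "fst v = l * fst u" "snd v = l * snd u" by (auto simp: proportional_def)
  then show ?thesis unfolding proportional_def by (intro exI[of _ "inverse l"]) auto
qed

lemma proportional_trans: "proportional u v \<Longrightarrow> proportional v w \<Longrightarrow> proportional u w"
proof -
  assume "proportional u v" "proportional v w"
  then obtain l k where "l \<noteq> 0" "fst v = l * fst u" "snd v = l * snd u"
    "k \<noteq> 0" "fst w = k * fst v" "snd w = k * snd v" by (auto simp: proportional_def)
  then show ?thesis unfolding proportional_def by (intro exI[of _ "k * l"]) auto
qed

lemma proportional_snd: "proportional u v \<Longrightarrow> snd u = 0 \<longleftrightarrow> snd v = 0"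
  by (auto simp: proportional_def)

lemma proportional_mirror_map: "proportional u v \<Longrightarrow> proportional (mirror_map z s u) (mirror_map z s v)"
proof -
  assume "proportional u v"
  then obtain l where "l \<noteq> 0" "fst v = l * fst u" "snd v = l * snd u" by (auto simp: proportional_def)
  then show ?thesis unfolding proportional_def
    by (cases u; cases v; cases s) (auto intro!: exI[of _ "cnj l"] simp: algebra_simps)
qed

lemma proportional_word_map: "proportional u v \<Longrightarrow> proportional (word_map z w u) (word_map z w v)"
  by (induction w) (simp_all add: proportional_mirror_map)

lemma mirror_map_invol: "z * cnj z = 1 \<Longrightarrow> mirror_map z s (mirror_map z s v) = v"
proof -
  assume z: "z * cnj z = 1"
  have "cnj z * (z * x) = x" for x using z by (simp add: mult_ac flip: mult.assoc)
  then show ?thesis by (cases v; cases s) simp_all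
qed

lemma word_map_rev: "z * cnj z = 1 \<Longrightarrow> word_map z (rev w) (word_map z w v) = v"
  by (induction w arbitrary: v) (simp_all add: mirror_map_invol)

text \<open>This is the power R_q^n at \<open>q = z\<close>; the sum is the q-integer [n].\<close>

lemma word_map_alt:
  assumes z: "z * cnj z = 1"
  shows "word_map z (alt MA MB (2 * n)) (x, y) = (z ^ n * x + (\<Sum>k<n. z ^ k) * y, y)"
    "word_map z (alt MB MA (2 * n)) (z ^ n * x + (\<Sum>k<n. z ^ k) * y, y) = (x, y)"
proof -
  show 1: "word_map z (alt MA MB (2 * n)) (x, y) = (z ^ n * x + (\<Sum>k<n. z ^ k) * y, y)" for n x y
  proof (induction n)
    case (Suc n)
    have "(\<Sum>k<Suc n. z ^ k) = z * (\<Sum>k<n. z ^ k) + 1"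
      by (simp add: sum.lessThan_Suc_shift sum_distrib_left del: sum.lessThan_Suc)
    then show ?case using Suc by (simp add: algebra_simps del: sum.lessThan_Suc)
  qed simp
  have "alt MB MA (2 * n) = rev (alt MA MB (2 * n))" by (simp add: rev_alt)
  then show "word_map z (alt MB MA (2 * n)) (z ^ n * x + (\<Sum>k<n. z ^ k) * y, y) = (x, y)"
    using 1 word_map_rev[OF z] by metis
qed

lemma word_map_dihedral:
  "set w \<subseteq> {MA, MB} \<Longrightarrow> snd (word_map z w (x, 0)) = 0"
proof (induction w)
  case (Cons s w)
  then show ?case by (cases "word_map z w (x, 0)") auto
qed simp

text \<open>The relation of order \<open>d\<close> holds because the q-integer [d] vanishes at a
  \<open>d\<close>-th root of unity other than 1. The two relations with \<open>MC\<close> hold on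
  the whole unit circle, but only up to the scalars \<open>- cnj z\<close> and -1.\<close>

lemma (in triangle) cox_eq_proportional:
  assumes "cox_eq w w'" and z: "z * cnj z = 1" and zd: "d > 0 \<Longrightarrow> z ^ d = 1 \<and> z \<noteq> 1"
  shows "proportional (word_map z w v) (word_map z w' v)"
  using assms(1)
proof (induction arbitrary: v rule: cox_eq.induct)
  case (sym w w')
  from sym.IH show ?case by (rule proportional_sym)
next
  case (trans w w' w'')
  from trans.IH show ?case by (rule proportional_trans)
next
  case (cancel u s w)
  then show ?case by (simp add: mirror_map_invol[OF z])
next
  case (braid s t u w)
  have key: "proportional (word_map z (alt s t (tri_m d s t)) v) (word_map z (alt t s (tri_m d s t)) v)"
    if st: "(s, t) = (MA, MB) \<or> (s, t) = (MA, MC) \<or> (s, t) = (MB, MC)" "d > 0 \<or> t = MC" for s t v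
  proof -
    obtain x y where v: "v = (x, y)" by (cases v)
    consider "s = MA" "t = MB" "d > 0" | "s = MA" "t = MC" | "s = MB" "t = MC" using st by auto
    then show ?thesis
    proof cases
      case 1
      have zz: "z ^ d = 1" "(\<Sum>k<d. z ^ k) = 0" using zd[OF 1(3)] by (simp_all add: sum_gp_strict)
      have "word_map z (alt MA MB (2 * d)) v' = v'" for v'
        using word_map_alt(1)[OF z, of d] zz by (cases v') simp
      moreover have "alt MA MB (2 * d) = alt MA MB d @ rev (alt MB MA d)"
        using alt_add[of MA MB d d] by (simp add: rev_alt mult_2)
      ultimately have "word_map z (alt MA MB d) v = word_map z (alt MB MA d) v"
        by (metis foldr_append o_apply word_map_rev[OF z] rev_rev_ident)
      then show ?thesis by (simp add: 1)
    next
      case 2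
      have "z \<noteq> 0" using z by auto
      moreover have "cnj z * (z * x) = x" for x using z by (simp add: mult_ac flip: mult.assoc)
      ultimately show ?thesis
        by (auto simp: 2 v eval_nat_numeral proportional_def intro!: exI[of _ "- cnj z"])
    next
      case 3
      then show ?thesis
        by (auto simp: v eval_nat_numeral proportional_def intro!: exI[of _ "- 1"])
    qed
  qed
  have "proportional (word_map z (alt s t (tri_m d s t)) (word_map z w v))
      (word_map z (alt t s (tri_m d s t)) (word_map z w v))"
    using key[of s t] key[of t s, THEN proportional_sym] braid by (cases s; cases t) auto
  then show ?case by (simp add: proportional_word_map)
qed simp

section \<open>Evaluating Laurent polynomials and \<open>q\<close>-rationals\<close>

lemma poly_map_X_power: "poly (map_poly of_int ([:0, 1:] ^ k)) z = (z :: complex) ^ k"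
  by (induction k) (simp_all add: map_poly_of_int_mult map_poly_pCons)

text \<open>Negative powers are cleared by a power of \<open>qv\<close>; for
  \<open>z \<noteq> 0\<close>, \<open>laurent_eval_eqI\<close> shows that the choice does not
  matter.\<close>

definition laurent_eval :: "complex \<Rightarrow> laurent \<Rightarrow> complex" where
  "laurent_eval z f =
     (SOME c. \<exists>n p. f * qv ^ n = laurent_of_poly p \<and> c = poly (map_poly of_int p) z / z ^ n)"

lemma laurent_eval_eqI:
  assumes "z \<noteq> 0" "f * qv ^ n = laurent_of_poly p"
  shows "laurent_eval z f = poly (map_poly of_int p) z / z ^ n"
  unfolding laurent_eval_def
proof (rule some_equality)
  show "\<exists>n' p'. f * qv ^ n' = laurent_of_poly p' \<and>
      poly (map_poly of_int p) z / z ^ n = poly (map_poly of_int p') z / z ^ n'"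
    using assms by blast
next
  fix c assume "\<exists>n' p'. f * qv ^ n' = laurent_of_poly p' \<and> c = poly (map_poly of_int p') z / z ^ n'"
  then obtain n' p' where p': "f * qv ^ n' = laurent_of_poly p'" "c = poly (map_poly of_int p') z / z ^ n'"
    by blast
  have "laurent_of_poly (p' * [:0, 1:] ^ n) = laurent_of_poly (p * [:0, 1:] ^ n')"
    unfolding laurent_of_poly_simps(5) laurent_of_poly_power p'(1)[symmetric] assms(2)[symmetric]
    by (simp add: mult_ac)
  then have "p' * [:0, 1:] ^ n = p * [:0, 1:] ^ n'" by (simp only: laurent_of_poly_inject)
  then have "poly (map_poly of_int p') z * z ^ n = poly (map_poly of_int p) z * z ^ n'"
    by (metis poly_map_X_power map_poly_of_int_mult poly_mult)
  then show "c = poly (map_poly of_int p) z / z ^ n"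
    using assms(1) by (simp add: p'(2) field_simps)
qed

lemma laurent_eval_poly [simp]: "z \<noteq> 0 \<Longrightarrow> laurent_eval z (laurent_of_poly p) = poly (map_poly of_int p) z"
  using laurent_eval_eqI[of z "laurent_of_poly p" 0 p] by simp

lemma laurent_of_poly_X: "laurent_of_poly [:0, 1:] = qv"
  by simp

lemma laurent_eval_mult [simp]:
  assumes "z \<noteq> 0"
  shows "laurent_eval z (f * g) = laurent_eval z f * laurent_eval z g"
proof -
  obtain n p where p: "f * qv ^ n = laurent_of_poly p" using laurent_shift by blast
  obtain k r where r: "g * qv ^ k = laurent_of_poly r" using laurent_shift by blast
  have pr: "(f * g) * qv ^ (n + k) = laurent_of_poly (p * r)"
    by (simp add: p[symmetric] r[symmetric] power_add mult_ac)
  show ?thesis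
    by (simp add: laurent_eval_eqI[OF assms pr] laurent_eval_eqI[OF assms p] laurent_eval_eqI[OF assms r]
        map_poly_of_int_mult power_add)
qed

lemma laurent_eval_add [simp]:
  assumes "z \<noteq> 0"
  shows "laurent_eval z (f + g) = laurent_eval z f + laurent_eval z g"
proof -
  obtain n p where p: "f * qv ^ n = laurent_of_poly p" using laurent_shift by blast
  obtain k r where r: "g * qv ^ k = laurent_of_poly r" using laurent_shift by blast
  have "(f + g) * qv ^ (n + k) = (f * qv ^ n) * qv ^ k + (g * qv ^ k) * qv ^ n"
    by (simp add: power_add algebra_simps)
  also have "\<dots> = laurent_of_poly (p * [:0, 1:] ^ k + r * [:0, 1:] ^ n)"
    unfolding p r by (simp only: laurent_of_poly_simps(3,5) laurent_of_poly_power laurent_of_poly_X)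
  finally have pr: "(f + g) * qv ^ (n + k) = \<dots>" .
  show ?thesis
    using assms
    by (simp add: laurent_eval_eqI[OF assms pr] laurent_eval_eqI[OF assms p] laurent_eval_eqI[OF assms r]
        map_poly_of_int_mult map_poly_of_int_add poly_map_X_power field_simps power_add)
qed

lemma laurent_eval_0 [simp]: "z \<noteq> 0 \<Longrightarrow> laurent_eval z 0 = 0"
  and laurent_eval_1 [simp]: "z \<noteq> 0 \<Longrightarrow> laurent_eval z 1 = 1"
  using laurent_eval_poly[of z 0] laurent_eval_poly[of z 1] by simp_all

lemma laurent_eval_qv [simp]: "z \<noteq> 0 \<Longrightarrow> laurent_eval z qv = z"
  using laurent_eval_poly[of z "[:0, 1:]"] by (simp add: map_poly_pCons)

lemma laurent_eval_qv_inv [simp]: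
  assumes "z \<noteq> 0"
  shows "laurent_eval z qv_inv = inverse z"
proof -
  have "z * laurent_eval z qv_inv = 1"
    using laurent_eval_mult[OF assms, of qv qv_inv] assms by (simp add: qv_mult_inv del: laurent_eval_mult)
  then show ?thesis by (simp add: inverse_unique)
qed

lemma laurent_eval_uminus [simp]:
  assumes "z \<noteq> 0"
  shows "laurent_eval z (- f) = - laurent_eval z f"
  using laurent_eval_add[OF assms, of f "- f"] assms by (simp add: eq_neg_iff_add_eq_0 add.commute del: laurent_eval_add)

text \<open>Coprimality passes from (P, Q) to (q P + Q, Q) because q is a unit; uniqueness of the
  normalised fraction does the rest.\<close>

lemma q_numer_denom_add_1:
  "q_numer (x + 1) = qv * q_numer x + laurent_of_poly (q_denom x)" (is ?N)
  "q_denom (x + 1) = q_denom x" (is ?D)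
proof -
  define P where "P = q_numer x"
  define Q where "Q = laurent_of_poly (q_denom x)"
  have PQ: "laurent_coprime P Q" "poly (q_denom x) 0 = 1" "q_rational x = Fraction_Field.Fract P Q"
    using is_q_fraction_q_numer_denom[of x] by (simp_all add: is_q_fraction_def P_def Q_def)
  have Q0: "Q \<noteq> 0" using PQ(2) laurent_of_poly_inject[of "q_denom x" 0] by (auto simp: Q_def)
  have "laurent_coprime (qv * P + Q) Q"
    unfolding laurent_coprime_def
  proof (intro allI impI)
    fix c assume c: "c dvd qv * P + Q" "c dvd Q"
    then have "c dvd qv * P" using dvd_diff[OF c] by simp
    then have "c dvd qv_inv * (qv * P)" by (rule dvd_mult)
    also have "qv_inv * (qv * P) = P" using qv_mult_inv_left[of P] by (simp add: mult_ac)
    finally show "c dvd 1" using PQ(1) c(2) by (simp add: laurent_coprime_def)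
  qed
  moreover have "q_rational (x + 1) = Fraction_Field.Fract (qv * P + Q) Q"
    unfolding q_rational_add_1 PQ(3) using Q0 by (simp add: One_fract_def)
  ultimately have "is_q_fraction (x + 1) (qv * P + Q) (q_denom x)"
    using PQ(2) by (simp add: is_q_fraction_def Q_def)
  then show ?N ?D
    using is_q_fraction_unique is_q_fraction_q_numer_denom unfolding P_def Q_def by blast+
qed

section \<open>Mirror words for continued fractions, rationals and integer matrices\<close>

definition first_column :: "complex \<Rightarrow> laurent^2^2 \<Rightarrow> complex \<times> complex" where
  "first_column z A = (laurent_eval z (A $ 1 $ 1), laurent_eval z (A $ 2 $ 1))"

text \<open>The product of the factors R^c S, spelled in mirrors.\<close>

definition hj_word :: "nat list \<Rightarrow> mirror list" where
  "hj_word cs = concat (map (\<lambda>c. alt MA MB (2 * c) @ [MA, MC]) cs)"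

lemma first_column_Rq: "z \<noteq> 0 \<Longrightarrow> z * cnj z = 1 \<Longrightarrow>
   first_column z (Rq ** A) = word_map z [MB, MA] (first_column z A)"
  by (simp add: first_column_def mat22_mult)

lemma first_column_Sq: "z \<noteq> 0 \<Longrightarrow> z * cnj z = 1 \<Longrightarrow>
   first_column z (Sq ** A) = word_map z [MA, MC] (first_column z A)"
  by (simp add: first_column_def mat22_mult inverse_unique)

lemma first_column_Mq:
  assumes "z * cnj z = 1"
  shows "first_column z (Mq cs) = word_map z (hj_word cs) (1, 0)"
proof (induction cs)
  case Nil
  have "z \<noteq> 0" using assms by auto
  then show ?case by (simp add: first_column_def hj_word_def)
next
  case (Cons c cs)
  have z: "z \<noteq> 0" using assms by auto
  have R: "first_column z (mat_pow Rq n ** A) = word_map z (alt MA MB (2 * n)) (first_column z A)" for n A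
  proof (induction n)
    case 0
    show ?case by (simp add: mat_pow_def)
  next
    case (Suc n)
    have "first_column z (mat_pow Rq (Suc n) ** A) = first_column z (Rq ** (mat_pow Rq n ** A))"
      by (simp add: mat_pow_Suc matrix_mul_assoc)
    then show ?case using Suc by (simp add: first_column_Rq[OF z assms])
  qed
  have "first_column z (Mq (c # cs)) = first_column z (mat_pow Rq c ** (Sq ** Mq cs))"
    by (simp add: matrix_mul_assoc)
  then show ?case unfolding R first_column_Sq[OF z assms] Cons by (simp add: hj_word_def)
qed

lemma even_length_hj_word: "even (length (hj_word cs))"
  by (induction cs) (simp_all add: hj_word_def)

text \<open>The undeformed counterpart of \<open>first_column_Mq\<close>. Each denominator is the
  preceding numerator, which is nonzero because the tail has value above 1.\<close>

lemma word_mat_hj_word: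
  assumes "cs \<noteq> []" "\<forall>c\<in>set cs. c \<ge> 2"
  shows "word_mat (hj_word cs) $ 2 $ 1 \<noteq> 0 \<and>
    hj_value cs = of_int (word_mat (hj_word cs) $ 1 $ 1) / of_int (word_mat (hj_word cs) $ 2 $ 1)"
  using assms
proof (induction cs rule: hj_value.induct)
  case (2 c)
  then show ?case by (simp add: hj_word_def word_mat_append word_mat_alt mat22_mult)
next
  case (3 c d cs)
  define A where "A = word_mat (hj_word (d # cs))"
  have IH: "A $ 2 $ 1 \<noteq> 0" "hj_value (d # cs) = of_int (A $ 1 $ 1) / of_int (A $ 2 $ 1)"
    using 3 by (auto simp: A_def)
  have A1: "A $ 1 $ 1 \<noteq> 0" using hj_value_bounds(1)[of "d # cs"] 3 IH by auto
  have "word_mat (hj_word (c # d # cs)) = word_mat (alt MA MB (2 * c)) ** (word_mat [MA, MC] ** A)"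
    by (simp add: A_def hj_word_def word_mat_append matrix_mul_assoc)
  then have entries: "word_mat (hj_word (c # d # cs)) $ 1 $ 1 = int c * A $ 1 $ 1 - A $ 2 $ 1"
    "word_mat (hj_word (c # d # cs)) $ 2 $ 1 = A $ 1 $ 1"
    by (simp_all add: mat22_mult word_mat_alt)
  show ?case using A1 IH(1) unfolding hj_value.simps IH(2) entries by (simp add: field_simps)
qed simp

text \<open>One word links both actions: its matrix sends infinity to \<open>x\<close>, and its
  deformation yields numerator and denominator exactly. For \<open>x \<le> 1\<close> the word of
  \<open>x + 1\<close> is preceded by \<open>[MA, MB]\<close>, the inverse of
  \<open>R\<close>.\<close>

lemma q_rational_word:
  "\<exists>w. even (length w) \<and> word_mat w $ 2 $ 1 \<noteq> 0 \<and>
     x = of_int (word_mat w $ 1 $ 1) / of_int (word_mat w $ 2 $ 1) \<and>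
     (\<forall>z. z * cnj z = 1 \<longrightarrow> word_map z w (1, 0) =
        (laurent_eval z (q_numer x), laurent_eval z (laurent_of_poly (q_denom x))))"
proof (induction "nat \<lceil>2 - x\<rceil>" arbitrary: x rule: less_induct)
  case less
  show ?case
  proof (cases "x > 1")
    case True
    define cs where "cs = hj_expansion x"
    have cs: "cs \<noteq> []" "\<forall>c\<in>set cs. c \<ge> 2" "hj_value cs = x"
      using hj_expansion[OF True] by (auto simp: is_hj_expansion_def cs_def)
    have "word_map z (hj_word cs) (1, 0) =
        (laurent_eval z (q_numer x), laurent_eval z (laurent_of_poly (q_denom x)))"
      if "z * cnj z = 1" for z
      unfolding q_numer_denom_gt_1[OF True] first_column_Mq[OF that, symmetric]
      by (simp add: first_column_def cs_def)
    then show ?thesis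
      using even_length_hj_word[of cs] word_mat_hj_word[OF cs(1,2)] unfolding cs(3) by blast
  next
    case False
    have "nat \<lceil>2 - (x + 1)\<rceil> < nat \<lceil>2 - x\<rceil>" using False by linarith
    from less[OF this] obtain w where w: "even (length w)" "word_mat w $ 2 $ 1 \<noteq> 0"
      "x + 1 = of_int (word_mat w $ 1 $ 1) / of_int (word_mat w $ 2 $ 1)"
      "\<And>z. z * cnj z = 1 \<Longrightarrow> word_map z w (1, 0) =
        (laurent_eval z (q_numer (x + 1)), laurent_eval z (laurent_of_poly (q_denom (x + 1))))"
      by blast
    have m: "word_mat ([MA, MB] @ w) $ 1 $ 1 = word_mat w $ 1 $ 1 - word_mat w $ 2 $ 1"
      "word_mat ([MA, MB] @ w) $ 2 $ 1 = word_mat w $ 2 $ 1"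
      by (simp_all add: mat22_mult)
    have "word_map z ([MA, MB] @ w) (1, 0) =
        (laurent_eval z (q_numer x), laurent_eval z (laurent_of_poly (q_denom x)))"
      if z: "z * cnj z = 1" for z
    proof -
      have "z \<noteq> 0" using z by auto
      then show ?thesis
        using w(4)[OF z, unfolded q_numer_denom_add_1] z
        by (simp add: algebra_simps)
    qed
    moreover have "x = of_int (word_mat ([MA, MB] @ w) $ 1 $ 1) / of_int (word_mat ([MA, MB] @ w) $ 2 $ 1)"
      using w(2,3) unfolding m by (simp add: diff_divide_distrib eq_diff_eq)
    ultimately show ?thesis using w(1,2) m by (intro exI[of _ "[MA, MB] @ w"]) simp
  qed
qed

text \<open>Both matrices send infinity to the same point, so their quotient \<open>D\<close> is
  upper triangular of determinant 1, that is, a translation up to sign.\<close>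

lemma word_of_SL2Z:
  assumes "det A = 1" "word_mat w $ 2 $ 1 * A $ 1 $ 1 = word_mat w $ 1 $ 1 * A $ 2 $ 1" "even (length w)"
  shows "\<exists>k. A = word_mat (w @ rot k) \<or> A = - word_mat (w @ rot k)"
proof -
  define B where "B = word_mat w"
  define D where "D = word_mat (rev w) ** A"
  have "A = word_mat w ** D" using word_mat_rev(2)[of w] by (simp add: D_def matrix_mul_assoc)
  have det: "B $ 1 $ 1 * B $ 2 $ 2 - B $ 1 $ 2 * B $ 2 $ 1 = 1"
    using det_word_mat_even[of w] assms(3) by (simp add: B_def det_2)
  define C where "C = (vector [vector [B $ 2 $ 2, - B $ 1 $ 2], vector [- B $ 2 $ 1, B $ 1 $ 1]] :: int^2^2)"
  have "C ** B = mat 1"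
    using det by (intro mat22_eqI) (simp_all add: C_def mat22_mult algebra_simps)
  then have "word_mat (rev w) = C"
    using word_mat_rev(2)[of w] unfolding B_def
    by (metis matrix_mul_assoc matrix_mul_lid matrix_mul_rid)
  then have D21: "D $ 2 $ 1 = 0" using assms(2) by (simp add: D_def C_def B_def mat22_mult)
  have "det D = 1" using assms(1,3) by (simp add: D_def det_mul det_word_mat_even)
  then have "D $ 1 $ 1 * D $ 2 $ 2 = 1" using D21 by (simp add: det_2)
  then have "(D $ 1 $ 1 = 1 \<and> D $ 2 $ 2 = 1) \<or> (D $ 1 $ 1 = -1 \<and> D $ 2 $ 2 = -1)"
    by (auto simp: zmult_eq_1_iff)
  then have "D = word_mat (rot (D $ 1 $ 2)) \<or> D = - word_mat (rot (- D $ 1 $ 2))"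
    using D21 by (auto intro!: mat22_eqI simp: word_mat_rot)
  then show ?thesis
    using \<open>A = word_mat w ** D\<close> by (metis word_mat_append minus_matrix_mult(2))
qed

lemma SL2Z_word:
  assumes "det A = 1"
  shows "\<exists>w. even (length w) \<and> (A = word_mat w \<or> A = - word_mat w)"
proof (cases "A $ 2 $ 1 = 0")
  case True
  then obtain k where "A = word_mat (rot k) \<or> A = - word_mat (rot k)"
    using word_of_SL2Z[OF assms, of "[]"] by auto
  then show ?thesis by (intro exI[of _ "rot k"]) simp
next
  case False
  obtain w where w: "even (length w)" "word_mat w $ 2 $ 1 \<noteq> 0"
    "(of_int (A $ 1 $ 1) / of_int (A $ 2 $ 1) :: rat) = of_int (word_mat w $ 1 $ 1) / of_int (word_mat w $ 2 $ 1)"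
    using q_rational_word by blast
  have "(of_int (word_mat w $ 2 $ 1 * A $ 1 $ 1) :: rat) = of_int (word_mat w $ 1 $ 1 * A $ 2 $ 1)"
    using w(2,3) False by (simp add: field_simps)
  then have "word_mat w $ 2 $ 1 * A $ 1 $ 1 = word_mat w $ 1 $ 1 * A $ 2 $ 1"
    by (simp only: of_int_eq_iff)
  then obtain k where "A = word_mat (w @ rot k) \<or> A = - word_mat (w @ rot k)"
    using word_of_SL2Z[OF assms] w(1) by blast
  then show ?thesis using w(1) by (intro exI[of _ "w @ rot k"]) simp
qed

section \<open>Divisibility by cyclotomic polynomials\<close>

lemma map_poly_of_int_inject:
  "(map_poly of_int p :: complex poly) = map_poly of_int r \<longleftrightarrow> p = r"
  by (auto simp: poly_eq_iff coeff_map_poly)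

lemma lead_coeff_cyclotomic: "lead_coeff (cyclotomic d) = 1"
  using complex_cyclotomic_int[of d] unfolding of_int_cyclotomic[of d, symmetric] map_poly_of_int_inject
  by blast

lemma prod_linear_factors_dvd:
  fixes p :: "'a::field poly"
  assumes "finite A" "inj_on f A" "\<And>k. k \<in> A \<Longrightarrow> poly p (f k) = 0"
  shows "(\<Prod>k\<in>A. [:- f k, 1:]) dvd p"
  using assms
proof (induction A arbitrary: p rule: finite_induct)
  case (insert a A)
  obtain q where q: "p = [:- f a, 1:] * q"
    using insert.prems(2)[of a] by (auto simp: poly_eq_0_iff_dvd dvd_def)
  have "poly q (f k) = 0" if "k \<in> A" for k
  proof -
    have "f k \<noteq> f a" using insert.hyps insert.prems(1) that by (auto simp: inj_on_def)
    then show ?thesis using insert.prems(2)[of k] that by (simp add: q)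
  qed
  then have "(\<Prod>k\<in>A. [:- f k, 1:]) dvd q"
    using insert by (intro insert.IH) (auto simp: inj_on_def)
  then show ?case using insert.hyps by (simp add: q mult_dvd_mono del: mult_pCons_left)
qed simp

lemma primitive_root:
  assumes "d \<ge> 2" "k \<in> totatives d"
  shows "cis (2 * pi * real k / real d) ^ d = 1" "cis (2 * pi * real k / real d) \<noteq> 1"
    "inj_on (\<lambda>k. cis (2 * pi * real k / real d)) (totatives d)"
proof -
  have bij: "bij_betw (\<lambda>k. cis (2 * pi * real k / real d)) {..<d} {z. z ^ d = 1}"
    using assms by (intro Complex.bij_betw_roots_unity) simp
  have sub: "totatives d \<subseteq> {..<d}" using assms(1) totatives_less by auto
  have inj: "inj_on (\<lambda>k. cis (2 * pi * real k / real d)) {..<d}"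
    using bij by (rule bij_betw_imp_inj_on)
  show "inj_on (\<lambda>k. cis (2 * pi * real k / real d)) (totatives d)"
    using inj sub by (rule inj_on_subset)
  show "cis (2 * pi * real k / real d) ^ d = 1"
    using bij_betwE[OF bij] sub assms(2) by blast
  have "k \<noteq> 0" using assms(2) by (auto simp: totatives_def)
  then show "cis (2 * pi * real k / real d) \<noteq> 1"
    using inj_onD[OF inj, of k 0] sub assms by auto
qed

text \<open>For the converse, the distinct linear factors divide the cleared polynomial over the
  complex numbers, and the quotient has integer coefficients because the divisor is monic.\<close>

lemma cyclotomic_dvd_laurent_iff:
  assumes "d \<ge> 2"
  shows "laurent_of_poly (cyclotomic d) dvd f \<longleftrightarrow>
    (\<forall>k\<in>totatives d. laurent_eval (cis (2 * pi * real k / real d)) f = 0)"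
proof
  assume "laurent_of_poly (cyclotomic d) dvd f"
  then obtain g where g: "f = laurent_of_poly (cyclotomic d) * g" by (rule dvdE)
  show "\<forall>k\<in>totatives d. laurent_eval (cis (2 * pi * real k / real d)) f = 0"
    unfolding g by (auto simp: of_int_cyclotomic complex_cyclotomic_def poly_prod)
next
  assume roots: "\<forall>k\<in>totatives d. laurent_eval (cis (2 * pi * real k / real d)) f = 0"
  obtain n p where p: "f * qv ^ n = laurent_of_poly p" using laurent_shift by blast
  have "poly (map_poly of_int p) (cis (2 * pi * real k / real d)) = 0" if "k \<in> totatives d" for k
    using roots that laurent_eval_eqI[OF _ p, of "cis (2 * pi * real k / real d)"] by simp
  moreover have "1 \<in> totatives d" using assms by (auto simp: totatives_def)
  ultimately have "complex_cyclotomic d dvd map_poly of_int p"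
    unfolding complex_cyclotomic_def using primitive_root(3)[OF assms]
    by (intro prod_linear_factors_dvd) auto
  then obtain h :: "complex poly" where h: "map_poly of_int p = map_poly of_int (cyclotomic d) * h"
    unfolding of_int_cyclotomic by (rule dvdE)
  then obtain r where "h = map_poly of_int r"
    using monic_dvd_of_int[OF lead_coeff_cyclotomic] by blast
  with h have "p = cyclotomic d * r"
    by (simp only: map_poly_of_int_mult[symmetric] map_poly_of_int_inject)
  then have "laurent_of_poly (cyclotomic d) dvd f * qv ^ n" by (simp add: p)
  then have "laurent_of_poly (cyclotomic d) dvd f * qv ^ n * qv_inv ^ n" by (rule dvd_mult2)
  then show "laurent_of_poly (cyclotomic d) dvd f" by (simp add: mult.assoc qv_power_inv)
qed

section \<open>Normal closure in the modular group\<close>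

lemma word_mat_cancel:
  "word_mat (rev w) ** (word_mat w ** A) = A" "word_mat w ** (word_mat (rev w) ** A) = A"
  "mirror_mat s ** (mirror_mat s ** A) = A"
  by (simp_all add: matrix_mul_assoc word_mat_rev mirror_mat_square)

section \<open>Elements of the modular group as even mirror words\<close>

interpretation PSL: group PSL2Z
  by (rule group_PSL2Z)

text \<open>For words of odd length this is a pair of determinant -1, outside the carrier of
  \<open>PSL2Z\<close>.\<close>

definition word_PSL :: "mirror list \<Rightarrow> (int^2^2) set" where
  "word_PSL w = to_PSL2Z (word_mat w)"

lemma to_PSL2Z_eq_iff: "to_PSL2Z A = to_PSL2Z B \<longleftrightarrow> A = B \<or> A = - B"
  by (auto simp: to_PSL2Z_eq doubleton_eq_iff)

lemma word_PSL_closed [simp]: "even (length w) \<Longrightarrow> word_PSL w \<in> carrier PSL2Z"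
  by (simp add: word_PSL_def carrier_PSL2Z det_word_mat_even)

lemma word_PSL_append:
  assumes "even (length u)" "even (length v)"
  shows "word_PSL (u @ v) = word_PSL u \<otimes>\<^bsub>PSL2Z\<^esub> word_PSL v"
proof -
  have "word_mat u \<in> carrier SL2Z" "word_mat v \<in> carrier SL2Z"
    using assms by (simp_all add: SL2Z_def det_word_mat_even)
  from normal.rcos_sum[OF normal_center_SL2Z this] show ?thesis
    by (simp add: word_PSL_def to_PSL2Z_def PSL2Z_def FactGroup_def word_mat_append)
      (simp add: SL2Z_def)
qed

lemma word_PSL_Nil: "word_PSL [] = \<one>\<^bsub>PSL2Z\<^esub>"
  by (simp add: word_PSL_def to_PSL2Z_eq PSL2Z_def FactGroup_def)

lemma word_PSL_rev:
  assumes "even (length w)"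
  shows "word_PSL (rev w) = inv\<^bsub>PSL2Z\<^esub> (word_PSL w)"
proof -
  have "word_PSL (rev w @ w) = \<one>\<^bsub>PSL2Z\<^esub>"
    using word_PSL_Nil by (simp add: word_PSL_def word_mat_append word_mat_rev)
  then show ?thesis using assms by (intro PSL.inv_equality[symmetric]) (simp_all add: word_PSL_append)
qed

lemma word_PSL_surj:
  assumes "g \<in> carrier PSL2Z"
  shows "\<exists>w. even (length w) \<and> g = word_PSL w"
proof -
  obtain A where A: "det A = 1" "g = to_PSL2Z A" using assms by (auto simp: carrier_PSL2Z)
  then show ?thesis using SL2Z_word[OF A(1)] unfolding word_PSL_def A(2) to_PSL2Z_eq_iff by blast
qed

lemma R_PSL_word: "R_PSL = word_PSL [MB, MA]"
  unfolding R_PSL_def word_PSL_def by (intro arg_cong[of _ _ to_PSL2Z] mat22_eqI) (simp_all add: mat22_mult)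

lemma S_PSL_word: "S_PSL = word_PSL [MA, MC]"
  unfolding S_PSL_def word_PSL_def by (intro arg_cong[of _ _ to_PSL2Z] mat22_eqI) (simp_all add: mat22_mult)

lemma R_PSL_closed [simp]: "R_PSL \<in> carrier PSL2Z"
  by (simp add: R_PSL_word)

lemma R_PSL_nat_pow: "R_PSL [^]\<^bsub>PSL2Z\<^esub> n = word_PSL (alt MA MB (2 * n))"
proof (induction n)
  case (Suc n)
  have "R_PSL [^]\<^bsub>PSL2Z\<^esub> Suc n = word_PSL [MB, MA] \<otimes>\<^bsub>PSL2Z\<^esub> word_PSL (alt MA MB (2 * n))"
    unfolding Suc[symmetric] R_PSL_word[symmetric] by (rule PSL.nat_pow_Suc2) simp
  then show ?case by (simp flip: word_PSL_append)
qed (simp add: word_PSL_Nil)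

lemma R_PSL_int_pow: "R_PSL [^]\<^bsub>PSL2Z\<^esub> k = word_PSL (rot k)" for k :: int
proof (cases "k \<ge> 0")
  case True
  define n where "n = nat k"
  have "k = int n" "rot k = alt MA MB (2 * n)" using True by (simp_all add: n_def rot_def)
  then show ?thesis by (simp only: int_pow_int R_PSL_nat_pow)
next
  case False
  define n where "n = nat (- k)"
  have "k = - int n" "rot k = rev (alt MA MB (2 * n))" using False by (simp_all add: n_def rot_def rev_alt)
  then show ?thesis by (simp only: PSL.int_pow_neg_int R_PSL_closed R_PSL_nat_pow) (simp add: word_PSL_rev)
qed

lemma normal_normal_closure:
  assumes "group G" "X \<subseteq> carrier G"
  shows "normal_closure G X \<lhd> G"
proof -
  interpret group G by fact
  have G: "carrier G \<lhd> G" by (intro normal_invI subgroup_self) simp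
  have "subgroup (normal_closure G X) G"
    unfolding normal_closure_def
  proof (rule subgroups_Inter)
    show "subgroup N G" if "N \<in> {N. N \<lhd> G \<and> X \<subseteq> N}" for N
      using that normal_invE(1) by blast
    show "{N. N \<lhd> G \<and> X \<subseteq> N} \<noteq> {}" using G assms(2) by blast
  qed
  moreover have "x \<otimes>\<^bsub>G\<^esub> h \<otimes>\<^bsub>G\<^esub> inv\<^bsub>G\<^esub> x \<in> normal_closure G X"
    if "x \<in> carrier G" "h \<in> normal_closure G X" for x h
    unfolding normal_closure_def
  proof (rule InterI)
    fix N assume N: "N \<in> {N. N \<lhd> G \<and> X \<subseteq> N}"
    then have "h \<in> N" using that(2) by (auto simp: normal_closure_def)
    then show "x \<otimes>\<^bsub>G\<^esub> h \<otimes>\<^bsub>G\<^esub> inv\<^bsub>G\<^esub> x \<in> N" using N that(1) by (intro normal_invE(2)) auto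
  qed
  ultimately show ?thesis by (rule normal_invI)
qed

lemma N_sub_normal: "N_sub d \<lhd> PSL2Z"
  unfolding N_sub_def by (intro normal_normal_closure group_PSL2Z) simp

lemma R_pow_in_N_sub: "word_PSL (alt MA MB (2 * d)) \<in> N_sub d"
  using R_PSL_nat_pow[of d] by (auto simp: N_sub_def normal_closure_def)

section \<open>The normal closure as the kernel of the map to the triangle group\<close>

context triangle
begin

text \<open>The words that become trivial form a normal subgroup containing the \<open>d\<close>-th
  power of \<open>R\<close>, hence its normal closure.\<close>

lemma N_sub_subset: "N_sub d \<subseteq> word_PSL ` {w. cox_eq w []}" if "d > 0"
proof -
  let ?K = "word_PSL ` {w. cox_eq w []}"
  have even: "even (length w)" if "cox_eq w []" for w
    using cox_eq_parity[OF that] by simp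
  have conj: "cox_eq (u @ w @ rev u) []" if "cox_eq w []" for u w
    using trans[OF cox_eq_context[OF that, of u "rev u"]] cox_eq_cancel_rev[of u] by simp
  have "subgroup ?K PSL2Z"
  proof (rule PSL.subgroupI)
    show "?K \<subseteq> carrier PSL2Z" using even by auto
    show "?K \<noteq> {}" using refl[of "[]"] by blast
    show "inv\<^bsub>PSL2Z\<^esub> a \<in> ?K" if "a \<in> ?K" for a
    proof -
      obtain w where w: "cox_eq w []" "a = word_PSL w" using \<open>a \<in> ?K\<close> by blast
      have "cox_eq (rev w) (rev w @ w)" using cox_eq_append[OF refl sym[OF w(1)], of "rev w"] by simp
      also have "cox_eq (rev w @ w) []" by (rule cox_eq_rev_cancel)
      finally show ?thesis using w even by (auto simp flip: word_PSL_rev)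
    qed
    show "a \<otimes>\<^bsub>PSL2Z\<^esub> b \<in> ?K" if "a \<in> ?K" "b \<in> ?K" for a b
    proof -
      obtain u v where uv: "cox_eq u []" "a = word_PSL u" "cox_eq v []" "b = word_PSL v"
        using \<open>a \<in> ?K\<close> \<open>b \<in> ?K\<close> by blast
      have "cox_eq (u @ v) []" using cox_eq_append[OF uv(1,3)] by simp
      then show ?thesis using uv even by (auto simp flip: word_PSL_append)
    qed
  qed
  moreover have "x \<otimes>\<^bsub>PSL2Z\<^esub> h \<otimes>\<^bsub>PSL2Z\<^esub> inv\<^bsub>PSL2Z\<^esub> x \<in> ?K" if "x \<in> carrier PSL2Z" "h \<in> ?K" for x h
  proof -
    obtain u where u: "even (length u)" "x = word_PSL u" using word_PSL_surj \<open>x \<in> carrier PSL2Z\<close> by blast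
    obtain w where w: "cox_eq w []" "h = word_PSL w" using \<open>h \<in> ?K\<close> by blast
    have "x \<otimes>\<^bsub>PSL2Z\<^esub> h \<otimes>\<^bsub>PSL2Z\<^esub> inv\<^bsub>PSL2Z\<^esub> x = word_PSL ((u @ w) @ rev u)"
      using u even[OF w(1)] by (simp add: w(2) word_PSL_append word_PSL_rev PSL.m_assoc del: append_assoc)
    then show ?thesis using conj[OF w(1)] by auto
  qed
  ultimately have "?K \<lhd> PSL2Z" by (rule PSL.normal_invI)
  moreover have "R_PSL [^]\<^bsub>PSL2Z\<^esub> d \<in> ?K"
    using cox_eq_alt[of MA MB] that by (auto simp: R_PSL_nat_pow)
  ultimately show ?thesis by (auto simp: N_sub_def normal_closure_def)
qed

text \<open>Relators involving \<open>MC\<close> are trivial up to sign; the others are the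
  \<open>d\<close>-th power of \<open>R\<close> and its inverse.\<close>

lemma braid_conj_in_N_sub:
  assumes st: "s \<noteq> t" and u: "even (length u)"
  shows "word_PSL (u @ alt s t (2 * tri_m d s t) @ rev u) \<in> N_sub d"
proof -
  interpret N: normal "N_sub d" PSL2Z by (rule N_sub_normal)
  have "word_PSL (alt s t (2 * tri_m d s t)) \<in> N_sub d"
  proof -
    have "alt MB MA (2 * d) = rev (alt MA MB (2 * d))" by (simp add: rev_alt)
    then have "word_PSL (alt MB MA (2 * d)) \<in> N_sub d"
      using R_pow_in_N_sub[of d] by (simp add: word_PSL_rev)
    moreover have "word_PSL (alt s t (2 * tri_m d s t)) = \<one>\<^bsub>PSL2Z\<^esub>" if "s = MC \<or> t = MC"
    proof -
      have "word_mat (alt s t (2 * tri_m d s t)) = mat 1 \<or> word_mat (alt s t (2 * tri_m d s t)) = - mat 1"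
        using st that
        by (cases s; cases t) (auto intro!: mat22_eqI simp: mat22_mult eval_nat_numeral)
      then show ?thesis unfolding word_PSL_Nil[symmetric] word_PSL_def to_PSL2Z_eq_iff by simp
    qed
    ultimately show ?thesis using st R_pow_in_N_sub[of d] by (cases s; cases t) auto
  qed
  from N.inv_op_closed2[OF word_PSL_closed[OF u] this] show ?thesis
    using u by (simp add: word_PSL_append word_PSL_rev PSL.m_assoc)
qed

text \<open>Conjugation by \<open>t\<close> exchanges the two letters, which reduces odd \<open>u\<close> to even \<open>u\<close>.\<close>

lemma braid_conj_in_N_sub':
  assumes st: "s \<noteq> t" and m0: "tri_m d s t > 0"
  shows "word_PSL (u @ alt s t (2 * tri_m d s t) @ rev u) \<in> N_sub d"
proof (cases "even (length u)")
  case False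
  define n where "n = tri_m d s t"
  have n: "tri_m d t s = n" unfolding n_def by (rule m_sym)
  obtain j where "n = Suc j" using m0 unfolding n_def[symmetric] by (cases n) auto
  then obtain k where k: "2 * n = Suc k" "odd k" using that[of "Suc (2 * j)"] by simp
  have "alt s t (2 * n) = t # alt t s k" "alt t s (2 * n) = alt t s k @ [t]"
    using alt_add[of t s k 1] k by simp_all
  then have "word_mat (u @ alt s t (2 * n) @ rev u) =
      word_mat ((u @ [t]) @ alt t s (2 * n) @ rev (u @ [t]))"
    by (simp add: word_mat_append word_mat_cancel flip: matrix_mul_assoc)
  then show ?thesis
    using braid_conj_in_N_sub[of t s "u @ [t]"] False st
    unfolding word_PSL_def n n_def[symmetric] by simp
qed (use assms braid_conj_in_N_sub in blast)

text \<open>A braid step multiplies by a conjugate of a relator, since the common tail cancels. The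
  words may be odd, but \<open>w @ rev w'\<close> is even and so lies in the modular group.\<close>

lemma cox_eq_N_sub:
  assumes "cox_eq w w'"
  shows "word_PSL (w @ rev w') \<in> N_sub d"
proof -
  interpret N: normal "N_sub d" PSL2Z by (rule N_sub_normal)
  have one: "word_PSL w \<in> N_sub d" if "word_mat w = mat 1" for w
    using N.one_closed that word_PSL_Nil by (simp add: word_PSL_def)
  have even: "even (length (u @ rev v))" if "cox_eq u v" for u v
    using cox_eq_parity[OF that] by simp
  show ?thesis
    using assms
  proof (induction rule: cox_eq.induct)
    case (refl w)
    show ?case by (intro one) (simp add: word_mat_append word_mat_rev)
  next
    case (sym v w)
    have "word_PSL (rev (v @ rev w)) \<in> N_sub d"
      using sym.IH unfolding word_PSL_rev[OF even[OF sym.hyps]] by (rule N.m_inv_closed)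
    then show ?case by simp
  next
    case (trans u v w)
    have "word_mat (u @ rev w) = word_mat ((u @ rev v) @ (v @ rev w))"
      by (simp add: word_mat_append word_mat_cancel flip: matrix_mul_assoc)
    then have "word_PSL (u @ rev w) = word_PSL (u @ rev v) \<otimes>\<^bsub>PSL2Z\<^esub> word_PSL (v @ rev w)"
      using even trans.hyps unfolding word_PSL_def[of "u @ rev w"] by (simp only: flip: word_PSL_def word_PSL_append)
    then show ?case using trans.IH by simp
  next
    case (cancel u s v)
    have "word_mat (u @ [s, s] @ v) = word_mat (u @ v)"
      by (simp add: word_mat_append word_mat_cancel flip: matrix_mul_assoc)
    then have "word_mat ((u @ [s, s] @ v) @ rev (u @ v)) = mat 1"
      by (simp only: word_mat_append[of _ "rev (u @ v)"] word_mat_rev)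
    then show ?case by (rule one)
  next
    case (braid s t u v)
    have "alt s t (2 * tri_m d s t) = alt s t (tri_m d s t) @ rev (alt t s (tri_m d s t))"
      using alt_add[of s t "tri_m d s t" "tri_m d s t"] by (simp add: rev_alt mult_2)
    then have "word_mat ((u @ alt s t (tri_m d s t) @ v) @ rev (u @ alt t s (tri_m d s t) @ v)) =
        word_mat (u @ alt s t (2 * tri_m d s t) @ rev u)"
      by (simp add: word_mat_append word_mat_cancel flip: matrix_mul_assoc)
    then show ?case using braid_conj_in_N_sub'[OF braid] unfolding word_PSL_def by simp
  qed
qed

text \<open>In the Coxeter group an even word in \<open>MA\<close> and \<open>MB\<close> is a power
  of \<open>R\<close>, and words equal there differ by an element of \<open>N_sub d\<close>.\<close>

lemma RN_sub_iff:
  assumes "d > 0" "even (length w)"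
  shows "word_PSL w \<in> RN_sub d \<longleftrightarrow> (\<exists>w'. set w' \<subseteq> {MA, MB} \<and> cox_eq w w')"
proof
  assume "word_PSL w \<in> RN_sub d"
  then obtain k :: int and n where n: "n \<in> N_sub d" "word_PSL w = R_PSL [^]\<^bsub>PSL2Z\<^esub> k \<otimes>\<^bsub>PSL2Z\<^esub> n"
    by (auto simp: RN_sub_def set_mult_def PSL.generate_pow)
  obtain u where u: "cox_eq u []" "n = word_PSL u" using N_sub_subset[OF assms(1)] n(1) by blast
  have "word_PSL w = word_PSL (rot k @ u)"
    using n(2) cox_eq_parity[OF u(1)] by (simp add: u(2) R_PSL_int_pow word_PSL_append)
  then have "cox_eq w (rot k @ u)"
    unfolding word_PSL_def to_PSL2Z_eq_iff by (rule cox_eq_of_word_mat)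
  also have "cox_eq \<dots> (rot k @ [])" by (intro cox_eq_append refl u)
  finally show "\<exists>w'. set w' \<subseteq> {MA, MB} \<and> cox_eq w w'" using set_rot by auto
next
  assume "\<exists>w'. set w' \<subseteq> {MA, MB} \<and> cox_eq w w'"
  then obtain w' where w': "set w' \<subseteq> {MA, MB}" "cox_eq w w'" by blast
  then have "even (length w')" using cox_eq_parity assms(2) by blast
  then obtain k where "cox_eq w' (rot k)" using dihedral_word w'(1) by blast
  with w'(2) have "cox_eq w (rot k)" by (rule trans)
  then have "cox_eq (rev (rot k) @ w) (rev (rot k) @ rot k)" by (intro cox_eq_append refl)
  also have "cox_eq \<dots> []" by (rule cox_eq_rev_cancel)
  finally have n: "word_PSL (rev (rot k) @ w) \<in> N_sub d"
    using cox_eq_N_sub[of "rev (rot k) @ w" "[]"] by simp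
  have "word_mat w = word_mat (rot k @ rev (rot k) @ w)"
    by (simp add: word_mat_append word_mat_cancel flip: matrix_mul_assoc)
  then have "word_PSL w = R_PSL [^]\<^bsub>PSL2Z\<^esub> k \<otimes>\<^bsub>PSL2Z\<^esub> word_PSL (rev (rot k) @ w)"
    using assms(2) by (simp add: R_PSL_int_pow word_PSL_def[of w] flip: word_PSL_append) (simp add: word_PSL_def)
  then show "word_PSL w \<in> RN_sub d"
    using n by (auto simp: RN_sub_def set_mult_def PSL.generate_pow)
qed

lemma RN_sub_iff_vanishing:
  assumes d: "d \<ge> 2" and "even (length w)"
  shows "word_PSL w \<in> RN_sub d \<longleftrightarrow>
    (\<forall>k\<in>totatives d. snd (word_map (cis (2 * pi * real k / real d)) w (1, 0)) = 0)"
proof -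
  have "d > 0" using d by simp
  show ?thesis unfolding RN_sub_iff[OF \<open>d > 0\<close> assms(2)]
  proof
    assume "\<exists>w'. set w' \<subseteq> {MA, MB} \<and> cox_eq w w'"
    then obtain w' where w': "set w' \<subseteq> {MA, MB}" "cox_eq w w'" by blast
    show "\<forall>k\<in>totatives d. snd (word_map (cis (2 * pi * real k / real d)) w (1, 0)) = 0"
    proof
      fix k assume k: "k \<in> totatives d"
      let ?z = "cis (2 * pi * real k / real d)"
      have "proportional (word_map ?z w (1, 0)) (word_map ?z w' (1, 0))"
        using w'(2) primitive_root(1,2)[OF d k] by (intro cox_eq_proportional) (simp_all add: cis_cnj cis_mult)
      then show "snd (word_map ?z w (1, 0)) = 0"
        using word_map_dihedral[OF w'(1)] proportional_snd by blast
    qed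
  next
    assume *: "\<forall>k\<in>totatives d. snd (word_map (cis (2 * pi * real k / real d)) w (1, 0)) = 0"
    \<comment> \<open>Index 1 is the root exp(2 pi i / d), at which the three forms transform like
      simple roots.\<close>
    have "1 \<in> totatives d" using d by (auto simp: totatives_def)
    with * have "snd (word_map (cis (2 * (pi / real d))) w (1, 0)) = 0" by force
    from word_fixes_infinity[OF this] show "\<exists>w'. set w' \<subseteq> {MA, MB} \<and> cox_eq w w'" by blast
  qed
qed

end

section \<open>Cyclotomic factors of denominators and numerators\<close>

theorem theorem1p2:
  fixes d :: nat and r s :: int and g :: "(int^2^2) set"
  assumes "d \<ge> 2"
    and "coprime r s" and "s > 0"
    and "g \<in> carrier PSL2Z"
    and "PSL_act g Infty = Fin (of_int r / of_int s)"
  shows "(laurent_of_poly (cyclotomic d) dvd laurent_of_poly (q_denom (of_int r / of_int s))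
           \<longleftrightarrow> g \<in> RN_sub d) \<and>
         (laurent_of_poly (cyclotomic d) dvd q_numer (of_int r / of_int s)
           \<longleftrightarrow> g \<in> S_PSL <#\<^bsub>PSL2Z\<^esub> RN_sub d)"
proof -
  interpret triangle d using assms(1) by unfold_locales simp
  define x where "x = (of_int r / of_int s :: rat)"
  obtain A where A: "det A = 1" "g = to_PSL2Z A" using assms(4) by (auto simp: carrier_PSL2Z)
  have "mobius A Infty = Fin x" using assms(5) by (simp add: A(2) PSL_act_to_PSL2Z x_def)
  then have A21: "A $ 2 $ 1 \<noteq> 0" "x = of_int (A $ 1 $ 1) / of_int (A $ 2 $ 1)"
    by (auto split: if_splits)
  obtain v where v: "even (length v)" "word_mat v $ 2 $ 1 \<noteq> 0"
    "x = of_int (word_mat v $ 1 $ 1) / of_int (word_mat v $ 2 $ 1)"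
    "\<And>z. z * cnj z = 1 \<Longrightarrow> word_map z v (1, 0) =
        (laurent_eval z (q_numer x), laurent_eval z (laurent_of_poly (q_denom x)))"
    using q_rational_word[of x] by blast
  have "(of_int (word_mat v $ 2 $ 1 * A $ 1 $ 1) :: rat) = of_int (word_mat v $ 1 $ 1 * A $ 2 $ 1)"
    using A21 v(2,3) by (simp add: field_simps)
  then have "word_mat v $ 2 $ 1 * A $ 1 $ 1 = word_mat v $ 1 $ 1 * A $ 2 $ 1"
    by (simp only: of_int_eq_iff)
  then obtain j where j: "A = word_mat (v @ rot j) \<or> A = - word_mat (v @ rot j)"
    using word_of_SL2Z[OF A(1)] v(1) by blast
  define w where "w = v @ rot j"
  have w: "even (length w)" "g = word_PSL w"
    using v(1) j by (auto simp: w_def A(2) word_PSL_def to_PSL2Z_eq_iff)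
  \<comment> \<open>The factor \<open>rot j\<close> fixes infinity up to a scalar, so
    \<open>w\<close> still yields the right point of the projective line.\<close>
  have w_map: "proportional (word_map z w (1, 0))
      (laurent_eval z (q_numer x), laurent_eval z (laurent_of_poly (q_denom x)))"
    if z: "z * cnj z = 1" for z
  proof -
    have z0: "z \<noteq> 0" using z by auto
    have "snd (word_map z (rot j) (1, 0)) = 0" using set_rot by (rule word_map_dihedral)
    moreover have "word_map z (rot j) (1, 0) \<noteq> (0, 0)" using z0 by (intro word_map_nonzero) simp_all
    ultimately have "proportional (1, 0) (word_map z (rot j) (1, 0))"
      unfolding proportional_def
      by (intro exI[of _ "fst (word_map z (rot j) (1, 0))"]) (auto simp: prod_eq_iff)
    from proportional_word_map[OF this, of z v] show ?thesis
      unfolding v(4)[OF z, symmetric] by (simp add: w_def proportional_sym)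
  qed
  have unit: "cis a * cnj (cis a) = 1" for a by (simp add: cis_cnj cis_mult)
  have "laurent_of_poly (cyclotomic d) dvd laurent_of_poly (q_denom x) \<longleftrightarrow> g \<in> RN_sub d"
    unfolding w(2) RN_sub_iff_vanishing[OF assms(1) w(1)] cyclotomic_dvd_laurent_iff[OF assms(1)]
    using proportional_snd[OF w_map[OF unit]] by (simp del: laurent_eval_poly)
  moreover have "laurent_of_poly (cyclotomic d) dvd q_numer x \<longleftrightarrow> word_PSL ([MA, MC] @ w) \<in> RN_sub d"
  proof -
    \<comment> \<open>Applying \<open>S\<close> moves the numerator into the second
      coordinate.\<close>
    have "snd (word_map z ([MA, MC] @ w) (1, 0)) = 0 \<longleftrightarrow> laurent_eval z (q_numer x) = 0"
      if z: "z * cnj z = 1" for z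
      using w_map[OF z] by (cases "word_map z w (1, 0)") (auto simp: proportional_def)
    then show ?thesis
      using w(1) unit by (subst RN_sub_iff_vanishing[OF assms(1)])
        (simp_all add: cyclotomic_dvd_laurent_iff[OF assms(1)] del: append.simps)
  qed
  moreover have "word_PSL ([MA, MC] @ w) \<in> RN_sub d \<longleftrightarrow> g \<in> S_PSL <#\<^bsub>PSL2Z\<^esub> RN_sub d"
  proof -
    have S: "S_PSL \<in> carrier PSL2Z" by (simp add: S_PSL_word)
    have "word_mat ([MA, MC] @ [MA, MC]) = - mat 1"
      by (intro mat22_eqI) (simp_all add: mat22_mult)
    \<comment> \<open>Since \<open>S\<close> is an involution, membership of \<open>g\<close> in the
      coset amounts to membership of \<open>S g\<close> in the subgroup.\<close>
    then have SS: "S_PSL \<otimes>\<^bsub>PSL2Z\<^esub> S_PSL = \<one>\<^bsub>PSL2Z\<^esub>"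
      unfolding S_PSL_word
      by (subst word_PSL_append[symmetric]) (simp_all add: word_PSL_def to_PSL2Z_eq_iff flip: word_PSL_Nil)
    have cancel: "S_PSL \<otimes>\<^bsub>PSL2Z\<^esub> (S_PSL \<otimes>\<^bsub>PSL2Z\<^esub> h) = h" if "h \<in> carrier PSL2Z" for h
      using that S SS by (simp flip: PSL.m_assoc)
    have sub: "RN_sub d \<subseteq> carrier PSL2Z"
    proof -
      interpret N: normal "N_sub d" PSL2Z by (rule N_sub_normal)
      show ?thesis unfolding RN_sub_def
        by (intro PSL.setmult_subset_G PSL.generate_incl N.subset) simp
    qed
    have "word_PSL ([MA, MC] @ w) = S_PSL \<otimes>\<^bsub>PSL2Z\<^esub> g"
      using w by (subst word_PSL_append) (simp_all add: S_PSL_word)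
    moreover have "S_PSL \<otimes>\<^bsub>PSL2Z\<^esub> g \<in> RN_sub d \<longleftrightarrow> g \<in> S_PSL <#\<^bsub>PSL2Z\<^esub> RN_sub d"
      using cancel[OF assms(4)] cancel sub unfolding l_coset_def by (auto 0 3)
    ultimately show ?thesis by simp
  qed
  ultimately show ?thesis by (simp only: x_def)
qed

end
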